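(* Let $\lambda>0$, $n\ge1$, and let $H_1^*,\dots,H_n^*$ be independent copies of the first hitting time process $H^*(t)=\inf\{s\ge0:\ G^*(s)>t\}$, where $G^*$ is a $1/2$-stable subordinator with $\mathbb{E}[e^{-sG^*(t)}]=e^{-ts^{1/2}}$. Let $H_*^n(t)=H_1^*\circ\cdots\circ H_n^*(t)$, let $N$ be a Poisson process with rate $\lambda$ independent of $H_1^*,\dots,H_n^*$, and let $p_k(x)=\mathbb{P}(N(x)=k)$. Then the probability mass function $q_k(t)=\mathbb{P}(N(H_*^n(t))=k)$, $k\ge0$, satisfies for $t>0$ $$\frac{d}{dt}q_k(t)=\lambda^{2^n}(1-\bigtriangledown)^{2^n}q_k(t)+\sum_{j=1}^{2^n-1}\Big((-\lambda)^j(1-\bigtriangledown)^jp_k(0)\Big)\frac{t^{-(2^n-j)/2^n}}{\Gamma\!\left(1-\frac{2^n-j}{2^n}\right)}.$$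
   Context: $\bigtriangledown$ is the backward shift operator in the index $k$: $\bigtriangledown f_k=f_{k-1}$, with the convention $f_i=0$ for $i<0$. The process $G^*$ is the inverse Gaussian subordinator $G(t)=\inf\{s>0:\ B(s)+\gamma s>\delta t\}$ ($B$ standard Brownian motion) with $\delta=1/\sqrt2$, $\gamma=0$. The Poisson process has $p_k(x)=e^{-\lambda x}(\lambda x)^k/k!$, so $p_0(0)=1$ and $p_k(0)=0$ for $k\ge1$. *)

theory Defs
  imports "HOL-Probability.Probability"
begin

text \<open>
  Processes are families \<open>X t \<omega>\<close> indexed by real times \<open>t\<close>; only times \<open>t \<ge> 0\<close> are meaningful.
\<close>

context prob_space
begin

definition independent_increments :: "(real \<Rightarrow> 'a \<Rightarrow> real) \<Rightarrow> bool" where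
  "independent_increments X \<longleftrightarrow>
     (\<forall>(m::nat) (t :: nat \<Rightarrow> real). 0 \<le> t 0 \<and> (\<forall>i<m. t i \<le> t (Suc i)) \<longrightarrow>
        indep_vars (\<lambda>_. borel) (\<lambda>i \<omega>. X (t (Suc i)) \<omega> - X (t i) \<omega>) {..<m})"

definition stationary_increments :: "(real \<Rightarrow> 'a \<Rightarrow> real) \<Rightarrow> bool" where
  "stationary_increments X \<longleftrightarrow>
     (\<forall>s\<ge>0. \<forall>h\<ge>0. distr M borel (\<lambda>\<omega>. X (s + h) \<omega> - X s \<omega>) = distr M borel (X h))"

definition cadlag_paths :: "(real \<Rightarrow> 'a \<Rightarrow> real) \<Rightarrow> bool" where
  "cadlag_paths X \<longleftrightarrow>
     (\<forall>\<omega>\<in>space M.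
        (\<forall>t\<ge>0. continuous (at_right t) (\<lambda>s. X s \<omega>)) \<and>
        (\<forall>t>0. \<exists>l. ((\<lambda>s. X s \<omega>) \<longlongrightarrow> l) (at_left t)))"

text \<open>
  Stochastic continuity is not listed: it follows from right-continuity and stationarity of
  the increments.
\<close>

definition levy_process :: "(real \<Rightarrow> 'a \<Rightarrow> real) \<Rightarrow> bool" where
  "levy_process X \<longleftrightarrow>
     (\<forall>t\<ge>0. random_variable borel (X t)) \<and>
     (AE \<omega> in M. X 0 \<omega> = 0) \<and>
     independent_increments X \<and> stationary_increments X \<and> cadlag_paths X"

definition subordinator :: "(real \<Rightarrow> 'a \<Rightarrow> real) \<Rightarrow> bool" where
  "subordinator X \<longleftrightarrow> levy_process X \<and> (\<forall>\<omega>\<in>space M. mono_on {0..} (\<lambda>t. X t \<omega>))"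

definition stable_subordinator :: "real \<Rightarrow> (real \<Rightarrow> 'a \<Rightarrow> real) \<Rightarrow> bool" where
  "stable_subordinator \<alpha> G \<longleftrightarrow>
     subordinator G \<and>
     (\<forall>t\<ge>0. \<forall>s\<ge>0. expectation (\<lambda>\<omega>. exp (- s * G t \<omega>)) = exp (- t * s powr \<alpha>))"

definition poisson_process :: "real \<Rightarrow> (real \<Rightarrow> 'a \<Rightarrow> nat) \<Rightarrow> bool" where
  "poisson_process r N \<longleftrightarrow>
     levy_process (\<lambda>t \<omega>. real (N t \<omega>)) \<and>
     (\<forall>t\<ge>0. \<forall>k. prob {\<omega> \<in> space M. N t \<omega> = k} = exp (- r * t) * (r * t) ^ k / fact k)"

definition independent_processes :: "('i \<Rightarrow> real \<Rightarrow> 'a \<Rightarrow> real) \<Rightarrow> 'i set \<Rightarrow> bool" where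
  "independent_processes X I \<longleftrightarrow>
     indep_vars (\<lambda>_. PiM {0..} (\<lambda>_. borel)) (\<lambda>i \<omega>. \<lambda>s\<in>{0..}. X i s \<omega>) I"

end

text \<open>
  A level that is never exceeded gets the value \<open>0\<close>, because \<open>Inf {}\<close> is unspecified
  on the reals. For a stable subordinator this happens with probability zero.
\<close>

definition first_hitting_process :: "(real \<Rightarrow> 'a \<Rightarrow> real) \<Rightarrow> real \<Rightarrow> 'a \<Rightarrow> real" where
  "first_hitting_process G t \<omega> =
     (if \<exists>s\<ge>0. G s \<omega> > t then Inf {s. 0 \<le> s \<and> G s \<omega> > t} else 0)"

text \<open>
  \<open>iterated_process H n t \<omega> = H 1 (H 2 (\<dots> (H n t \<omega>) \<dots>) \<omega>) \<omega>\<close>; the process with the largest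
  index is applied first.
\<close>

primrec iterated_process :: "(nat \<Rightarrow> real \<Rightarrow> 'a \<Rightarrow> real) \<Rightarrow> nat \<Rightarrow> real \<Rightarrow> 'a \<Rightarrow> real" where
  "iterated_process H 0 t \<omega> = t"
| "iterated_process H (Suc n) t \<omega> = iterated_process H n (H (Suc n) t \<omega>) \<omega>"

text \<open>The case \<open>k = 0\<close> is the convention that sequences vanish at negative indices.\<close>

definition backshift :: "(nat \<Rightarrow> real) \<Rightarrow> nat \<Rightarrow> real" where
  "backshift f k = (if k = 0 then 0 else f (k - 1))"

definition one_minus_backshift :: "(nat \<Rightarrow> real) \<Rightarrow> nat \<Rightarrow> real" where
  "one_minus_backshift f k = f k - backshift f k"

end

theory Submission
  imports Defs
begin

text \<open>
  By scaling, the first hitting time \<open>H t\<close> of a 1/2-stable subordinator \<open>G\<close> has the law of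
  \<open>sqrt (t / G 1)\<close>. Integrating the Laplace transform of \<open>G 1\<close> against \<open>u powr (b - 1)\<close> gives its
  negative moments, and hence \<open>E (H t powr a) = Gamma (a + 1) / Gamma (a / 2 + 1) * t powr (a / 2)\<close>.
  So averaging \<open>(\<Sum>j. c j * x powr (j * \<beta>) / Gamma (j * \<beta> + 1))\<close> over \<open>x = H t\<close> produces the same series
  at \<open>t\<close> with \<open>\<beta>\<close> replaced by \<open>\<beta> / 2\<close>. Starting from the power series of the Poisson
  probabilities, whose coefficients are \<open>c j = (- r) ^ j * (one_minus_backshift ^^ j) unit_mass k\<close>,
  \<open>n\<close> independent time changes lead to \<open>\<beta> = 1 / 2 ^ n\<close>. In the termwise derivative, the terms with
  \<open>j < 2 ^ n\<close> are the explicit sum, and the terms with \<open>j \<ge> 2 ^ n\<close> reproduce the series itself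
  because \<open>2 ^ n * \<beta> = 1\<close>.
\<close>

section \<open>Mittag-Leffler type series\<close>

text \<open>On \<open>{x..}\<close> the Gamma integrand is at least
  \<open>x powr s * exp (- u)\<close>, whose integral over that half-line is the left side. As
  \<open>x\<close> is free, Gamma outgrows every exponential in \<open>s\<close>.\<close>

lemma Gamma_plus1_ge:
  fixes x s :: real
  assumes "0 < x" "0 \<le> s"
  shows "x powr s * exp (- x) \<le> Gamma (s + 1)"
proof -
  have tail: "((\<lambda>u. x powr s * exp (- u)) has_integral x powr s * exp (- x)) {x..}"
    using has_integral_mult_right[OF has_integral_exp_minus_to_infinity[of 1 x], of "x powr s"] by simp
  have "((\<lambda>u. if u \<in> {x..} then x powr s * exp (- u) else 0) has_integral x powr s * exp (- x)) {0..}"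
    using assms by (subst has_integral_restrict) (auto intro: tail)
  moreover have "((\<lambda>u. u powr s / exp u) has_integral Gamma (s + 1)) {0..}"
    using Gamma_integral_real[of "s + 1"] assms by simp
  ultimately show ?thesis
    by (rule has_integral_le) (use assms in \<open>auto simp: exp_minus field_simps intro!: powr_mono2\<close>)
qed

lemma summable_power_div_Gamma:
  fixes z \<beta> :: real
  assumes "0 < \<beta>"
  shows "summable (\<lambda>j. z ^ j / Gamma (real j * \<beta> + 1))"
proof -
  \<comment> \<open>Chosen so that \<open>x powr (j * \<beta>)\<close> dominates
    \<open>(2 * abs z) ^ j\<close>: the factor 2 leaves a geometric series of ratio 1/2, and the
    summand 1 keeps \<open>x\<close> positive when \<open>z = 0\<close>.\<close>
  define x where "x = (2 * \<bar>z\<bar> + 1) powr (1 / \<beta>)"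
  have x: "0 < x" "x powr \<beta> = 2 * \<bar>z\<bar> + 1"
    using assms by (simp_all add: x_def powr_powr)
  have "norm (z ^ j / Gamma (real j * \<beta> + 1)) \<le> exp x * (1 / 2) ^ j" for j
  proof -
    have "(2 * \<bar>z\<bar>) ^ j * exp (- x) \<le> (2 * \<bar>z\<bar> + 1) ^ j * exp (- x)"
      by (intro mult_right_mono power_mono) auto
    also have "\<dots> = x powr (real j * \<beta>) * exp (- x)"
      using x by (simp add: powr_powr[symmetric] powr_realpow mult.commute[of "real j"])
    also have "\<dots> \<le> Gamma (real j * \<beta> + 1)"
      using assms x by (intro Gamma_plus1_ge) auto
    finally have "2 ^ j * \<bar>z\<bar> ^ j \<le> exp x * Gamma (real j * \<beta> + 1)"
      by (simp add: exp_minus field_simps power_mult_distrib)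
    moreover have "0 < Gamma (real j * \<beta> + 1)"
      using assms by (intro Gamma_real_pos) (auto intro: add_nonneg_pos)
    ultimately show ?thesis
      by (simp add: abs_mult power_abs field_simps)
  qed
  moreover have "summable (\<lambda>j. exp x * (1 / 2 :: real) ^ j)"
    by (rule summable_mult) (simp add: summable_geometric)
  ultimately show ?thesis
    by (rule summable_comparison_test'[rotated])
qed

text \<open>The geometric bound on \<open>a\<close> only rescales \<open>z\<close>. Absolute
  convergence is what later permits interchanging the series with an expectation.\<close>

lemma summable_mittag_leffler:
  fixes a :: "nat \<Rightarrow> real" and C z \<beta> :: real
  assumes "0 < \<beta>" and a: "\<And>j. \<bar>a j\<bar> \<le> C ^ j"
  shows "summable (\<lambda>j. \<bar>a j * z ^ j / Gamma (real j * \<beta> + 1)\<bar>)"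
proof (rule summable_comparison_test')
  show "summable (\<lambda>j. (C * \<bar>z\<bar>) ^ j / Gamma (real j * \<beta> + 1))"
    using assms(1) by (rule summable_power_div_Gamma)
  fix j :: nat
  have "0 < Gamma (real j * \<beta> + 1)"
    using assms by (intro Gamma_real_pos) (auto intro: add_nonneg_pos)
  then show "norm \<bar>a j * z ^ j / Gamma (real j * \<beta> + 1)\<bar> \<le> (C * \<bar>z\<bar>) ^ j / Gamma (real j * \<beta> + 1)"
    using a[of j] by (auto simp: abs_mult power_abs power_mult_distrib intro!: divide_right_mono mult_right_mono)
qed

lemma powr_real_mult_power:
  assumes "0 < (x::real)"
  shows "(x powr b) ^ j = x powr (real j * b)"
  using assms by (simp add: powr_powr powr_realpow[symmetric] mult.commute)

text \<open>The series is an everywhere convergent power series in \<open>t powr \<beta>\<close>, so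
  termwise differentiation and the chain rule apply. The recurrence of Gamma absorbs the factor
  \<open>j * \<beta>\<close>, and for \<open>j = i + m\<close> the identity
  \<open>m * \<beta> = 1\<close> restores the original shape of a term.\<close>

lemma mittag_leffler_has_derivative:
  fixes a :: "nat \<Rightarrow> real" and C t :: real and m :: nat
  assumes m: "1 \<le> m" and a: "\<And>j. \<bar>a j\<bar> \<le> C ^ j" and t: "0 < t"
  defines "\<beta> \<equiv> 1 / real m"
  shows "((\<lambda>t. \<Sum>j. a j * (t powr \<beta>) ^ j / Gamma (real j * \<beta> + 1)) has_real_derivative
      (\<Sum>i. a (i + m) * (t powr \<beta>) ^ i / Gamma (real i * \<beta> + 1))
       + (\<Sum>j = 1..m - 1. a j * (t powr (real j * \<beta> - 1) / Gamma (real j * \<beta>)))) (at t)"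
proof -
  have \<beta>: "0 < \<beta>" "real m * \<beta> = 1"
    using m by (simp_all add: \<beta>_def)
  define b where "b j = a j / Gamma (real j * \<beta> + 1)" for j
  have sum_b: "summable (\<lambda>j. b j * y ^ j)" for y
    using summable_mittag_leffler[OF \<beta>(1) a, of y, THEN summable_rabs_cancel] by (simp add: b_def)
  have G: "0 < Gamma (real j * \<beta> + 1)" for j
    using \<beta> by (intro Gamma_real_pos) (auto intro: add_nonneg_pos)
  have D: "((\<lambda>t. \<Sum>j. b j * (t powr \<beta>) ^ j) has_real_derivative
      (\<Sum>j. diffs b j * (t powr \<beta>) ^ j) * (\<beta> * t powr (\<beta> - 1))) (at t)"
  proof -
    have P: "((\<lambda>z. \<Sum>j. b j * z ^ j) has_real_derivative (\<Sum>j. diffs b j * (t powr \<beta>) ^ j)) (at (t powr \<beta>))"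
      using sum_b by (rule termdiffs_strong_converges_everywhere)
    show ?thesis
      using DERIV_chain2[OF P has_real_derivative_powr[OF t]] .
  qed
  define c where "c j = diffs b j * (t powr \<beta>) ^ j * (\<beta> * t powr (\<beta> - 1))" for j
  have c_eq: "c j = a (Suc j) * (t powr (real (Suc j) * \<beta> - 1) / Gamma (real (Suc j) * \<beta>))" for j
  proof -
    have "Gamma (real (Suc j) * \<beta> + 1) = real (Suc j) * \<beta> * Gamma (real (Suc j) * \<beta>)"
      using \<beta> by (intro Gamma_plus1) (metis mult_pos_pos nonpos_Ints_nonpos not_le of_nat_0_less_iff zero_less_Suc)
    then have "c j = a (Suc j) * ((t powr \<beta>) ^ j * t powr (\<beta> - 1)) / Gamma (real (Suc j) * \<beta>)"
      using \<beta> by (simp add: c_def diffs_def b_def)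
    also have "(t powr \<beta>) ^ j * t powr (\<beta> - 1) = t powr (real (Suc j) * \<beta> - 1)"
      using t by (simp add: powr_real_mult_power powr_add[symmetric] algebra_simps)
    finally show ?thesis by simp
  qed
  have "summable (\<lambda>j. diffs b j * (t powr \<beta>) ^ j)"
    by (rule termdiff_converges_all) (rule sum_b)
  then have c: "summable c" "suminf c = (\<Sum>j. diffs b j * (t powr \<beta>) ^ j) * (\<beta> * t powr (\<beta> - 1))"
    unfolding c_def by (rule summable_mult2, rule suminf_mult2[symmetric])
  \<comment> \<open>\<open>c j\<close> comes from the term of index \<open>Suc j\<close>, so cutting
    off \<open>m - 1\<close> terms leaves the original indices from \<open>m\<close> on.\<close>
  have "suminf c = (\<Sum>i. c (i + (m - 1))) + (\<Sum>j<m - 1. c j)"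
    using c(1) by (rule suminf_split_initial_segment)
  also have "(\<Sum>j<m - 1. c j) = (\<Sum>j = 1..m - 1. a j * (t powr (real j * \<beta> - 1) / Gamma (real j * \<beta>)))"
  proof -
    have "(\<Sum>j = 1..m - 1. a j * (t powr (real j * \<beta> - 1) / Gamma (real j * \<beta>))) = (\<Sum>j\<in>Suc ` {..<m - 1}. a j * (t powr (real j * \<beta> - 1) / Gamma (real j * \<beta>)))"
      by (rule sum.cong) (simp_all add: image_Suc_lessThan)
    then show ?thesis
      by (simp add: sum.reindex c_eq)
  qed
  also have "(\<lambda>i. c (i + (m - 1))) = (\<lambda>i. a (i + m) * (t powr \<beta>) ^ i / Gamma (real i * \<beta> + 1))"
  proof
    fix i
    have "real (Suc (i + (m - 1))) * \<beta> = real i * \<beta> + 1"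
      using m \<beta>(2) by (simp add: of_nat_diff algebra_simps)
    then show "c (i + (m - 1)) = a (i + m) * (t powr \<beta>) ^ i / Gamma (real i * \<beta> + 1)"
      unfolding c_eq using t m by (simp add: powr_real_mult_power)
  qed
  finally show ?thesis
    using D c(2) by (simp add: b_def)
qed

section \<open>Powers of \<open>one_minus_backshift\<close> and the Poisson probabilities\<close>

definition unit_mass :: "nat \<Rightarrow> real" where
  "unit_mass i = (if i = 0 then 1 else 0)"

text \<open>\<open>unit_mass\<close>, the Poisson distribution at time 0, has generating function 1,
  and each application multiplies it by \<open>1 - z\<close>. The induction step is Pascal's rule
  with signs.\<close>

lemma backshift_pow_choose:
  "(one_minus_backshift ^^ j) unit_mass k = (- 1) ^ k * real (j choose k)"
proof (induction j arbitrary: k)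
  case 0
  show ?case by (cases k) (auto simp: unit_mass_def)
next
  case (Suc j)
  show ?case
  proof -
    have "(one_minus_backshift ^^ Suc j) unit_mass k =
        (one_minus_backshift ^^ j) unit_mass k - backshift ((one_minus_backshift ^^ j) unit_mass) k"
      by (simp add: one_minus_backshift_def)
    then show ?thesis
      by (cases k) (simp_all add: Suc backshift_def algebra_simps)
  qed
qed

text \<open>Both claims are proved together and for all \<open>k\<close>: splitting the series of a
  difference uses summability of the previous power at \<open>k\<close> and at
  \<open>k - 1\<close>.\<close>

lemma backshift_pow_suminf:
  fixes f :: "nat \<Rightarrow> nat \<Rightarrow> real"
  assumes "\<And>k. summable (\<lambda>i. f i k)"
  shows "summable (\<lambda>i. (one_minus_backshift ^^ m) (f i) k)
    \<and> (one_minus_backshift ^^ m) (\<lambda>k. \<Sum>i. f i k) k = (\<Sum>i. (one_minus_backshift ^^ m) (f i) k)"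
proof (induction m arbitrary: k)
  case 0
  then show ?case using assms by simp
next
  case (Suc m)
  then show ?case
    by (auto simp: one_minus_backshift_def backshift_def suminf_diff intro!: summable_diff)
qed

lemma backshift_pow_cmult:
  "(one_minus_backshift ^^ m) (\<lambda>k. c * f k) k = c * (one_minus_backshift ^^ m) f k"
  by (induction m arbitrary: k) (auto simp: one_minus_backshift_def backshift_def algebra_simps)

text \<open>The series of \<open>exp (- y)\<close> is multiplied by \<open>y ^ k / fact k\<close>
  and reindexed by \<open>j = i + k\<close>. The terms with \<open>j < k\<close> contribute nothing
  because the binomial coefficient vanishes.\<close>

lemma poisson_pmf_sums:
  fixes y :: real
  shows "(\<lambda>j. (- 1) ^ k * real (j choose k) * (- y) ^ j / fact j) sums (exp (- y) * y ^ k / fact k)"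
proof -
  have "(\<lambda>i. (- y) ^ i / fact i * (y ^ k / fact k)) sums (exp (- y) * (y ^ k / fact k))"
    using exp_converges[of "- y"] by (intro sums_mult2) (simp add: scaleR_conv_of_real field_simps)
  also have "(\<lambda>i. (- y) ^ i / fact i * (y ^ k / fact k)) =
      (\<lambda>i. (- 1) ^ k * real ((i + k) choose k) * (- y) ^ (i + k) / fact (i + k))"
  proof
    fix i
    have "real ((i + k) choose k) = fact (i + k) / (fact k * fact i)"
      by (subst binomial_fact) auto
    moreover have "(- 1) ^ k * (- y) ^ k = y ^ k"
      by (simp add: power_mult_distrib[symmetric])
    ultimately show "(- y) ^ i / fact i * (y ^ k / fact k) =
        (- 1) ^ k * real ((i + k) choose k) * (- y) ^ (i + k) / fact (i + k)"
      by (simp add: power_add field_simps)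
  qed
  finally have "(\<lambda>i. (- 1) ^ k * real ((i + k) choose k) * (- y) ^ (i + k) / fact (i + k)) sums (exp (- y) * y ^ k / fact k)"
    by simp
  then show ?thesis
    by (subst (asm) sums_iff_shift) (simp add: binomial_eq_0)
qed

section \<open>Laplace transforms\<close>

text \<open>Right continuity lets \<open>y\<close> decrease to \<open>x\<close>. Distribution
  functions can thus be compared with a small gap, which avoids boundary events.\<close>

lemma cdf_le_if_less:
  assumes "real_distribution \<nu>"
    and "\<And>x y. x < y \<Longrightarrow> cdf \<mu> x \<le> cdf \<nu> y"
  shows "cdf \<mu> x \<le> cdf \<nu> x"
proof -
  interpret \<nu>: real_distribution \<nu> by fact
  have "(cdf \<nu> \<longlongrightarrow> cdf \<nu> x) (at_right x)"
    using \<nu>.cdf_is_right_cont[of x] by (simp add: continuous_within)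
  moreover have "eventually (\<lambda>y. cdf \<mu> x \<le> cdf \<nu> y) (at_right x)"
    using assms(2) by (auto simp: eventually_at_filter)
  ultimately show ?thesis
    by (rule tendsto_lowerbound) simp
qed

text \<open>A polynomial in \<open>w = exp (- x)\<close> integrates to a combination of Laplace
  transform values at integers, so a uniform approximation of the step function controls its
  integral by these values.\<close>

lemma (in real_distribution) integral_cts_step_approx:
  assumes nonneg: "AE x in M. 0 \<le> x" and "a < b"
    and approx: "\<And>w. w \<in> {0..1} \<Longrightarrow> \<bar>cts_step a b (- ln (max w (exp (- b)))) - (\<Sum>i\<le>n. c i * w ^ i)\<bar> \<le> e"
  shows "\<bar>integral\<^sup>L M (cts_step a b) - (\<Sum>i\<le>n. c i * integral\<^sup>L M (\<lambda>x. exp (- real i * x)))\<bar> \<le> e"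
proof -
  define p where "p x = (\<Sum>i\<le>n. c i * exp (- real i * x))" for x
  have int_exp: "integrable M (\<lambda>x. exp (- real i * x))" for i
    by (rule integrable_const_bound[where B = 1]) (use nonneg in \<open>auto elim!: eventually_mono\<close>)
  then have int_p: "integrable M p"
    unfolding p_def[abs_def] by (intro Bochner_Integration.integrable_sum integrable_mult_right)
  have "AE x in M. \<bar>cts_step a b x - p x\<bar> \<le> e"
    using nonneg
  proof eventually_elim
    case (elim x)
    \<comment> \<open>Truncating at \<open>exp (- b)\<close> changes nothing, because
      \<open>cts_step a b\<close> vanishes from \<open>b\<close> on.\<close>
    have "cts_step a b (- ln (max (exp (- x)) (exp (- b)))) = cts_step a b x"
    proof (cases "x \<le> b")
      case True
      then show ?thesis by (simp add: max_absorb1)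
    next
      case False
      then show ?thesis using \<open>a < b\<close> by (simp add: max_absorb2 cts_step_def)
    qed
    then show ?case
      using approx[of "exp (- x)"] elim by (simp add: p_def exp_of_nat_mult[symmetric])
  qed
  then have "integral\<^sup>L M (\<lambda>x. \<bar>cts_step a b x - p x\<bar>) \<le> integral\<^sup>L M (\<lambda>_. e)"
    using \<open>a < b\<close> int_p by (intro integral_mono_AE) (auto intro!: integrable_cts_step)
  then have "\<bar>integral\<^sup>L M (\<lambda>x. cts_step a b x - p x)\<bar> \<le> e"
    using prob_space by (intro order_trans[OF integral_abs_bound]) simp
  then show ?thesis
    using \<open>a < b\<close> int_p int_exp integrable_cts_step by (simp add: p_def[abs_def])
qed

text \<open>
  In the variable \<open>w = exp (- x) \<in> {0..1}\<close> the hypothesis says that all moments agree, so the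
  Weierstrass theorem applies.
\<close>

lemma Laplace_transform_uniqueness:
  assumes "real_distribution \<mu>" "real_distribution \<nu>"
    and "AE x in \<mu>. 0 \<le> x" "AE x in \<nu>. 0 \<le> x"
    and eq: "\<And>j::nat. integral\<^sup>L \<mu> (\<lambda>x. exp (- real j * x)) = integral\<^sup>L \<nu> (\<lambda>x. exp (- real j * x))"
  shows "\<mu> = \<nu>"
proof -
  interpret \<mu>: real_distribution \<mu> by fact
  interpret \<nu>: real_distribution \<nu> by fact
  have step: "integral\<^sup>L \<mu> (cts_step a b) = integral\<^sup>L \<nu> (cts_step a b)" if "a < b" for a b
  proof -
    \<comment> \<open>The truncation keeps the logarithm away from \<open>w = 0\<close>, so
      continuity holds on the whole compact interval.\<close>
    have "continuous_on {0..1} (\<lambda>w. cts_step a b (- ln (max w (exp (- b)))))"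
    proof (rule continuous_on_compose2[of UNIV "cts_step a b"])
      show "continuous_on UNIV (cts_step a b)"
        using that by (intro uniformly_continuous_imp_continuous cts_step_uniformly_continuous)
      show "continuous_on {0..1} (\<lambda>w. - ln (max w (exp (- b))))"
        by (intro continuous_intros) (smt (verit) exp_gt_zero)
    qed auto
    note cont = this
    have "\<bar>integral\<^sup>L \<mu> (cts_step a b) - integral\<^sup>L \<nu> (cts_step a b)\<bar> \<le> e" if "0 < e" for e
    proof -
      from that have "0 < e / 2" by simp
      from Stone_Weierstrass_real_polynomial_function[OF compact_Icc cont this]
      obtain g where g: "real_polynomial_function g"
        "\<And>w. w \<in> {0..1} \<Longrightarrow> \<bar>cts_step a b (- ln (max w (exp (- b)))) - g w\<bar> < e / 2" by blast
      obtain c n where "g = (\<lambda>w. \<Sum>i\<le>n. c i * w ^ i)"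
        using real_polynomial_function_imp_sum[OF g(1)] by blast
      with g have "\<And>w. w \<in> {0..1} \<Longrightarrow>
          \<bar>cts_step a b (- ln (max w (exp (- b)))) - (\<Sum>i\<le>n. c i * w ^ i)\<bar> \<le> e / 2"
        using less_imp_le by blast
      from \<mu>.integral_cts_step_approx[OF assms(3) \<open>a < b\<close> this]
        \<nu>.integral_cts_step_approx[OF assms(4) \<open>a < b\<close> this]
      show ?thesis
        unfolding eq by linarith
    qed
    then show ?thesis
      by (metis abs_le_zero_iff eq_iff_diff_eq_0 field_le_epsilon add_0)
  qed
  \<comment> \<open>The integral of \<open>cts_step x y\<close> lies between the values of the
    distribution function at \<open>x\<close> and at \<open>y\<close>.\<close>
  have "cdf \<mu> x \<le> cdf \<nu> y" "cdf \<nu> x \<le> cdf \<mu> y" if "x < y" for x y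
    using \<mu>.cdf_cts_step[OF that] \<nu>.cdf_cts_step[OF that] step[OF that] by linarith+
  then have "cdf \<mu> x = cdf \<nu> x" for x
    by (intro antisym cdf_le_if_less assms)
  then show ?thesis
    using assms by (intro cdf_unique) auto
qed

section \<open>Negative moments from the Laplace transform\<close>

text \<open>Writing \<open>exp (- sqrt u)\<close> as the integral of \<open>exp (- v)\<close> over
  \<open>v \<ge> sqrt u\<close> and exchanging the integrals replaces the substitution
  \<open>u = v\<^sup>2\<close>: the inner integral over \<open>u \<le> v\<^sup>2\<close> is
  \<open>v powr (2 * b) / b\<close>, and a Gamma integral remains.\<close>

lemma nn_integral_powr_exp_sqrt:
  fixes b :: real
  assumes "0 < b"
  shows "(\<integral>\<^sup>+u. ennreal (indicator {0..} u * u powr (b - 1) * exp (- sqrt u)) \<partial>lborel)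
    = ennreal (Gamma (2 * b + 1) / b)"
proof -
  have tail: "(\<integral>\<^sup>+v. ennreal (indicator {c..} v * exp (- v)) \<partial>lborel) = ennreal (exp (- c))" for c :: real
    using nn_integral_has_integral_lebesgue[OF _ has_integral_exp_minus_to_infinity[of 1 c]] by simp
  have head: "(\<integral>\<^sup>+u. ennreal (indicator {0..c} u * u powr (b - 1)) \<partial>lborel) = ennreal (c powr b / b)"
    if "0 \<le> c" for c :: real
    using nn_integral_has_integral_lebesgue[OF _ has_integral_powr_from_0[of "b - 1" c]] assms that by simp
  have "(\<integral>\<^sup>+u. ennreal (indicator {0..} u * u powr (b - 1) * exp (- sqrt u)) \<partial>lborel)
    = (\<integral>\<^sup>+u. \<integral>\<^sup>+v. ennreal (indicator {0..} u * u powr (b - 1)) * ennreal (indicator {sqrt u..} v * exp (- v)) \<partial>lborel \<partial>lborel)"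
    by (subst nn_integral_cmult) (simp_all add: tail ennreal_mult'[symmetric])
  also have "\<dots> = (\<integral>\<^sup>+v. \<integral>\<^sup>+u. ennreal (indicator {0..} u * u powr (b - 1)) * ennreal (indicator {sqrt u..} v * exp (- v)) \<partial>lborel \<partial>lborel)"
  proof (rule lborel_pair.Fubini')
    \<comment> \<open>As a comparison of two measurable functions, the indicator of the moving
      half-line is jointly measurable.\<close>
    have "(\<lambda>x. indicator {sqrt (snd x)..} (fst x) :: real) = (\<lambda>x. if sqrt (snd x) \<le> fst x then 1 else 0)"
      by (auto simp: indicator_def)
    then have [measurable]: "(\<lambda>x. indicator {sqrt (snd x)..} (fst x) :: real) \<in> borel_measurable (lborel \<Otimes>\<^sub>M lborel)"
      by simp
    show "(\<lambda>(v, u). ennreal (indicator {0..} u * u powr (b - 1)) * ennreal (indicator {sqrt u..} v * exp (- v)))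
        \<in> borel_measurable (lborel \<Otimes>\<^sub>M lborel)"
      unfolding case_prod_unfold by measurable
  qed
  also have "\<dots> = (\<integral>\<^sup>+v. ennreal (1 / b) * ennreal (indicator {0..} v * v powr (2 * b + 1 - 1) / exp v) \<partial>lborel)"
  proof (rule nn_integral_cong)
    fix v :: real
    show "(\<integral>\<^sup>+u. ennreal (indicator {0..} u * u powr (b - 1)) * ennreal (indicator {sqrt u..} v * exp (- v)) \<partial>lborel)
      = ennreal (1 / b) * ennreal (indicator {0..} v * v powr (2 * b + 1 - 1) / exp v)"
    proof (cases "0 \<le> v")
      case True
      have "(\<integral>\<^sup>+u. ennreal (indicator {0..} u * u powr (b - 1)) * ennreal (indicator {sqrt u..} v * exp (- v)) \<partial>lborel)
        = (\<integral>\<^sup>+u. ennreal (indicator {0..v\<^sup>2} u * u powr (b - 1)) * ennreal (exp (- v)) \<partial>lborel)"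
      proof -
        have "sqrt u \<le> v \<longleftrightarrow> u \<le> v\<^sup>2" if "0 \<le> u" for u
          using True that by (metis sqrt_le_D real_le_lsqrt)
        then show ?thesis
          by (intro nn_integral_cong) (simp add: indicator_def)
      qed
      also have "\<dots> = ennreal ((v\<^sup>2) powr b / b) * ennreal (exp (- v))"
        by (subst nn_integral_multc) (simp_all add: head)
      also have "\<dots> = ennreal ((v\<^sup>2) powr b / b * exp (- v))"
        using assms by (intro ennreal_mult'[symmetric]) simp
      also have "(v\<^sup>2) powr b = v powr (2 * b)"
        using True by (cases "v = 0") (simp_all add: powr_powr powr_numeral[symmetric, of v] del: powr_numeral)
      finally show ?thesis
        using True assms by (simp add: ennreal_mult'[symmetric] exp_minus field_simps)
    next
      case False
      then have "ennreal (indicator {0..} u * u powr (b - 1)) * ennreal (indicator {sqrt u..} v * exp (- v)) = 0" for u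
        using False by (auto simp: indicator_def dest: order_trans[OF real_sqrt_ge_zero])
      then have "(\<integral>\<^sup>+u. ennreal (indicator {0..} u * u powr (b - 1)) * ennreal (indicator {sqrt u..} v * exp (- v)) \<partial>lborel) = 0"
        by (simp only: nn_integral_const mult_zero_left)
      with False show ?thesis by simp
    qed
  qed
  also have "\<dots> = ennreal (1 / b) * ennreal (Gamma (2 * b + 1))"
    using assms by (subst nn_integral_cmult) (simp_all add: Gamma_conv_nn_integral_real)
  finally show ?thesis
    using assms by (simp add: ennreal_mult'[symmetric])
qed

lemma nn_integral_powr_exp_mult:
  fixes b x :: real
  assumes "0 < b" "0 < x"
  shows "(\<integral>\<^sup>+u. ennreal (indicator {0..} u * u powr (b - 1) * exp (- u * x)) \<partial>lborel)
    = ennreal (Gamma b * x powr (- b))"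
proof -
  have "ennreal (Gamma b) = ennreal \<bar>x\<bar> * (\<integral>\<^sup>+u. ennreal (indicator {0..} (0 + x * u) * (0 + x * u) powr (b - 1) / exp (0 + x * u)) \<partial>lborel)"
    unfolding Gamma_conv_nn_integral_real[OF assms(1)]
    by (rule nn_integral_real_affine) (use assms in auto)
  also have "\<dots> = ennreal x * (\<integral>\<^sup>+u. ennreal (x powr (b - 1)) * ennreal (indicator {0..} u * u powr (b - 1) * exp (- u * x)) \<partial>lborel)"
    using assms by (intro arg_cong2[where f = "(*)"] nn_integral_cong)
      (auto simp: indicator_def zero_le_mult_iff powr_mult ennreal_mult'[symmetric] exp_minus field_simps)
  also have "\<dots> = ennreal (x powr b) * (\<integral>\<^sup>+u. ennreal (indicator {0..} u * u powr (b - 1) * exp (- u * x)) \<partial>lborel)"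
    using assms by (subst nn_integral_cmult) (simp_all add: mult.assoc[symmetric] ennreal_mult'[symmetric] powr_diff)
  finally have "ennreal (x powr (- b)) * ennreal (Gamma b)
    = ennreal (x powr (- b)) * ennreal (x powr b) * (\<integral>\<^sup>+u. ennreal (indicator {0..} u * u powr (b - 1) * exp (- u * x)) \<partial>lborel)"
    by (simp add: mult.assoc)
  then show ?thesis
    using assms by (simp add: ennreal_mult'[symmetric] powr_add[symmetric] mult.commute)
qed

context prob_space
begin

text \<open>A Chernoff bound: on the event, \<open>exp (s * c) * exp (- s * X \<omega>)\<close> is
  at least 1.\<close>

lemma prob_le_if_Laplace:
  assumes [measurable]: "random_variable borel X"
    and "0 \<le> s" and L: "expectation (\<lambda>\<omega>. exp (- s * X \<omega>)) = exp (- x * sqrt s)"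
  shows "prob {\<omega> \<in> space M. X \<omega> \<le> c} \<le> exp (s * c - x * sqrt s)"
proof -
  \<comment> \<open>The integral of a non-integrable function is 0 by default, which a value of
    \<open>exp\<close> excludes.\<close>
  have int: "integrable M (\<lambda>\<omega>. exp (- s * X \<omega>))"
    using L by (metis exp_not_eq_zero not_integrable_integral_eq)
  have "prob {\<omega> \<in> space M. X \<omega> \<le> c} = expectation (indicator {\<omega> \<in> space M. X \<omega> \<le> c})"
    by simp
  also have "\<dots> \<le> expectation (\<lambda>\<omega>. exp (s * c) * exp (- s * X \<omega>))"
    using int \<open>0 \<le> s\<close> by (intro integral_mono integrable_real_indicator integrable_mult_right)
      (auto simp: indicator_def emeasure_eq_measure exp_add[symmetric] mult_left_mono)
  also have "\<dots> = exp (s * c) * exp (- x * sqrt s)"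
    using L by simp
  also have "\<dots> = exp (s * c - x * sqrt s)"
    by (simp add: exp_add[symmetric])
  finally show ?thesis .
qed

text \<open>The Chernoff bound with \<open>c = 0\<close> tends to 0 as \<open>s\<close>
  grows.\<close>

lemma AE_pos_if_Laplace:
  assumes [measurable]: "random_variable borel X"
    and "0 < x" and L: "\<And>s. 0 \<le> s \<Longrightarrow> expectation (\<lambda>\<omega>. exp (- s * X \<omega>)) = exp (- x * sqrt s)"
  shows "AE \<omega> in M. 0 < X \<omega>"
proof -
  have "((\<lambda>s. exp (- x * sqrt s)) \<longlongrightarrow> 0) at_top"
    using \<open>0 < x\<close> by real_asymp
  moreover have "eventually (\<lambda>s. prob {\<omega> \<in> space M. X \<omega> \<le> 0} \<le> exp (- x * sqrt s)) at_top"
    using eventually_ge_at_top[of 0]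
  proof eventually_elim
    case (elim s)
    then show ?case
      using prob_le_if_Laplace[of X s x 0] L by simp
  qed
  ultimately have "prob {\<omega> \<in> space M. X \<omega> \<le> 0} \<le> 0"
    by (rule tendsto_lowerbound) simp
  then show ?thesis
    by (subst (asm) measure_le_0_iff) (simp add: prob_eq_0 not_le)
qed

text \<open>\<open>Gamma b * X powr (- b)\<close> is the integral of
  \<open>u powr (b - 1) * exp (- u * X)\<close>. Working in \<open>ennreal\<close>, Tonelli
  exchanges it with the expectation without any prior finiteness, and the hypothesis on the Laplace
  transform leaves \<open>nn_integral_powr_exp_sqrt\<close>. The factors \<open>b\<close> and
  \<open>Gamma b\<close> merge into \<open>Gamma (b + 1)\<close>.\<close>

lemma nn_integral_negative_moment:
  assumes [measurable]: "random_variable borel X"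
    and L: "\<And>s. 0 \<le> s \<Longrightarrow> expectation (\<lambda>\<omega>. exp (- s * X \<omega>)) = exp (- sqrt s)"
    and "0 < b"
  shows "(\<integral>\<^sup>+\<omega>. ennreal (X \<omega> powr (- b)) \<partial>M) = ennreal (Gamma (2 * b + 1) / Gamma (b + 1))"
proof -
  have pos: "AE \<omega> in M. 0 < X \<omega>"
    using L by (intro AE_pos_if_Laplace[of X 1]) auto
  have "ennreal (Gamma b) * (\<integral>\<^sup>+\<omega>. ennreal (X \<omega> powr (- b)) \<partial>M) = (\<integral>\<^sup>+\<omega>. ennreal (Gamma b * X \<omega> powr (- b)) \<partial>M)"
    using \<open>0 < b\<close> by (subst nn_integral_cmult[symmetric]) (simp_all add: ennreal_mult')
  also have "\<dots> = (\<integral>\<^sup>+\<omega>. \<integral>\<^sup>+u. ennreal (indicator {0..} u * u powr (b - 1) * exp (- u * X \<omega>)) \<partial>lborel \<partial>M)"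
  proof (rule nn_integral_cong_AE)
    show "AE \<omega> in M. ennreal (Gamma b * X \<omega> powr (- b)) = (\<integral>\<^sup>+u. ennreal (indicator {0..} u * u powr (b - 1) * exp (- u * X \<omega>)) \<partial>lborel)"
      using pos by eventually_elim (rule nn_integral_powr_exp_mult[OF \<open>0 < b\<close>, symmetric])
  qed
  also have "\<dots> = (\<integral>\<^sup>+u. \<integral>\<^sup>+\<omega>. ennreal (indicator {0..} u * u powr (b - 1) * exp (- u * X \<omega>)) \<partial>M \<partial>lborel)"
  proof -
    interpret pair_sigma_finite lborel M ..
    show ?thesis by (rule Fubini') measurable
  qed
  also have "\<dots> = (\<integral>\<^sup>+u. ennreal (indicator {0..} u * u powr (b - 1) * exp (- sqrt u)) \<partial>lborel)"
  proof (rule nn_integral_cong)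
    fix u :: real
    show "(\<integral>\<^sup>+\<omega>. ennreal (indicator {0..} u * u powr (b - 1) * exp (- u * X \<omega>)) \<partial>M)
      = ennreal (indicator {0..} u * u powr (b - 1) * exp (- sqrt u))"
    proof (cases "0 \<le> u")
      case True
      have int: "integrable M (\<lambda>\<omega>. exp (- u * X \<omega>))"
        using L[OF True] by (metis exp_not_eq_zero not_integrable_integral_eq)
      have "(\<integral>\<^sup>+\<omega>. ennreal (indicator {0..} u * u powr (b - 1) * exp (- u * X \<omega>)) \<partial>M)
        = ennreal (u powr (b - 1)) * (\<integral>\<^sup>+\<omega>. ennreal (exp (- u * X \<omega>)) \<partial>M)"
        using True by (subst nn_integral_cmult[symmetric]) (simp_all add: ennreal_mult')
      also have "\<dots> = ennreal (u powr (b - 1)) * ennreal (exp (- sqrt u))"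
        using nn_integral_eq_integral[OF int] L[OF True] by simp
      finally show ?thesis
        using True by (simp add: ennreal_mult')
    qed simp
  qed
  also have "\<dots> = ennreal (Gamma (2 * b + 1) / b)"
    using \<open>0 < b\<close> by (rule nn_integral_powr_exp_sqrt)
  finally have "ennreal (1 / Gamma b) * ennreal (Gamma b) * (\<integral>\<^sup>+\<omega>. ennreal (X \<omega> powr (- b)) \<partial>M)
      = ennreal (1 / Gamma b) * ennreal (Gamma (2 * b + 1) / b)"
    by (simp add: mult.assoc)
  note scaled = this
  have G: "Gamma (b + 1) = b * Gamma b" "0 < Gamma b"
    using \<open>0 < b\<close> by (auto intro!: Gamma_plus1 simp: nonpos_Ints_altdef)
  have "ennreal (1 / Gamma b) * ennreal (Gamma b) = 1"
    "ennreal (1 / Gamma b) * ennreal (Gamma (2 * b + 1) / b) = ennreal (Gamma (2 * b + 1) / Gamma (b + 1))"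
    using G(2) unfolding G(1) by (subst ennreal_mult'[symmetric]; simp add: mult.commute)+
  note cancel = this
  show ?thesis
    using scaled unfolding cancel by (simp only: mult_1)
qed

end

section \<open>First hitting times of the 1/2-stable subordinator\<close>

lemma first_hitting_process_nonneg: "0 \<le> first_hitting_process G t \<omega>"
  unfolding first_hitting_process_def by (auto intro!: cInf_greatest)

lemma first_hitting_process_le:
  assumes "0 \<le> x" "t < G x \<omega>"
  shows "first_hitting_process G t \<omega> \<le> x"
  using assms unfolding first_hitting_process_def by (auto intro!: cInf_lower bdd_belowI[of _ 0])

context prob_space
begin

lemma stable_subordinator_half:
  assumes "stable_subordinator (1/2) G"
  shows "0 \<le> x \<Longrightarrow> random_variable borel (G x)"
    and "0 \<le> x \<Longrightarrow> 0 \<le> s \<Longrightarrow> expectation (\<lambda>\<omega>. exp (- s * G x \<omega>)) = exp (- x * sqrt s)"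
    and "\<omega> \<in> space M \<Longrightarrow> 0 \<le> x \<Longrightarrow> x \<le> y \<Longrightarrow> G x \<omega> \<le> G y \<omega>"
    and "0 \<le> x \<Longrightarrow> AE \<omega> in M. 0 \<le> G x \<omega>"
proof -
  have mono: "G x \<omega> \<le> G y \<omega>" if "\<omega> \<in> space M" "0 \<le> x" "x \<le> y" for \<omega> x y
    using assms that by (auto simp: stable_subordinator_def subordinator_def intro: mono_onD)
  \<comment> \<open>The process starts at 0 only almost surely, so the nonnegativity that
    monotonicity yields at later times is almost sure as well.\<close>
  have "AE \<omega> in M. G 0 \<omega> = 0"
    using assms by (simp add: stable_subordinator_def subordinator_def levy_process_def)
  then show "AE \<omega> in M. 0 \<le> G x \<omega>" if "0 \<le> x" for x
    using AE_space by eventually_elim (use mono that in fastforce)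
  show "random_variable borel (G x)" if "0 \<le> x" for x
    using assms that by (simp add: stable_subordinator_def subordinator_def levy_process_def)
  show "expectation (\<lambda>\<omega>. exp (- s * G x \<omega>)) = exp (- x * sqrt s)" if "0 \<le> x" "0 \<le> s" for x s
    using assms that by (simp add: stable_subordinator_def powr_half_sqrt)
  show "G x \<omega> \<le> G y \<omega>" if "\<omega> \<in> space M" "0 \<le> x" "x \<le> y"
    using mono that .
qed

text \<open>Self-similarity: at \<open>j\<close> both Laplace transforms equal
  \<open>exp (- x * sqrt j)\<close>, since \<open>sqrt (j * x\<^sup>2) = x * sqrt j\<close>.\<close>

lemma stable_subordinator_half_scaling:
  assumes G: "stable_subordinator (1/2) G" and "0 \<le> x"
  shows "distr M borel (G x) = distr M borel (\<lambda>\<omega>. x\<^sup>2 * G 1 \<omega>)"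
proof (rule Laplace_transform_uniqueness)
  note [measurable] = stable_subordinator_half(1)[OF G]
  have [measurable]: "random_variable borel (G x)" "random_variable borel (G 1)"
    using \<open>0 \<le> x\<close> by simp_all
  show "real_distribution (distr M borel (G x))" "real_distribution (distr M borel (\<lambda>\<omega>. x\<^sup>2 * G 1 \<omega>))"
    by (rule real_distribution_distr; simp)+
  show "AE y in distr M borel (G x). 0 \<le> y"
    using stable_subordinator_half(4)[OF G \<open>0 \<le> x\<close>] by (simp add: AE_distr_iff)
  have "AE \<omega> in M. 0 \<le> x\<^sup>2 * G 1 \<omega>"
    using stable_subordinator_half(4)[OF G zero_le_one] by eventually_elim simp
  then show "AE y in distr M borel (\<lambda>\<omega>. x\<^sup>2 * G 1 \<omega>). 0 \<le> y"
    by (simp add: AE_distr_iff)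
  fix j :: nat
  have "expectation (\<lambda>\<omega>. exp (- (real j * x\<^sup>2) * G 1 \<omega>)) = exp (- 1 * sqrt (real j * x\<^sup>2))"
    by (rule stable_subordinator_half(2)[OF G]) auto
  then show "integral\<^sup>L (distr M borel (G x)) (\<lambda>y. exp (- real j * y))
    = integral\<^sup>L (distr M borel (\<lambda>\<omega>. x\<^sup>2 * G 1 \<omega>)) (\<lambda>y. exp (- real j * y))"
    using stable_subordinator_half(2)[OF G, of x "real j"] \<open>0 \<le> x\<close>
    by (simp add: integral_distr real_sqrt_mult mult_ac)
qed

text \<open>The Chernoff bound with \<open>s = 1\<close> at integer times tends to 0. Hence the
  default value in \<open>first_hitting_process\<close> occurs with probability zero.\<close>

lemma stable_subordinator_half_unbounded:
  assumes G: "stable_subordinator (1/2) G"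
  shows "AE \<omega> in M. \<exists>s\<ge>0. t < G s \<omega>"
proof -
  have [measurable]: "random_variable borel (G (real n))" for n
    using stable_subordinator_half(1)[OF G] by simp
  have "prob {\<omega> \<in> space M. \<forall>n. G (real n) \<omega> \<le> t} \<le> exp (t - real n)" for n
  proof -
    have "prob {\<omega> \<in> space M. \<forall>n. G (real n) \<omega> \<le> t} \<le> prob {\<omega> \<in> space M. G (real n) \<omega> \<le> t}"
      by (rule finite_measure_mono) auto
    also have "\<dots> \<le> exp (1 * t - real n * sqrt 1)"
      by (rule prob_le_if_Laplace) (use stable_subordinator_half(2)[OF G, of "real n" 1] in auto)
    finally show ?thesis by simp
  qed
  moreover have "(\<lambda>n. exp (t - real n)) \<longlonglongrightarrow> 0"
    by real_asymp
  ultimately have "prob {\<omega> \<in> space M. \<forall>n. G (real n) \<omega> \<le> t} \<le> 0"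
    by (intro LIMSEQ_le_const[of "\<lambda>n. exp (t - real n)"]) auto
  then have "AE \<omega> in M. \<exists>n. t < G (real n) \<omega>"
    by (subst (asm) measure_le_0_iff) (simp add: prob_eq_0 not_le)
  then show ?thesis
    by eventually_elim (use of_nat_0_le_iff in blast)
qed

text \<open>
  Up to boundary events, \<open>first_hitting_process G t \<le> x\<close> means \<open>t < G x\<close>, which by scaling has
  the probability of \<open>t < x\<^sup>2 * G 1\<close>. The cumulative distribution functions are only compared
  at \<open>x < y\<close>, which is enough because they are right continuous.
\<close>

lemma distr_first_hitting_process:
  assumes G: "stable_subordinator (1/2) G" and "0 < t"
    and [measurable]: "random_variable borel (first_hitting_process G t)"
  shows "distr M borel (first_hitting_process G t) = distr M borel (\<lambda>\<omega>. sqrt (t / G 1 \<omega>))"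
proof -
  define H where "H = first_hitting_process G t"
  define Z where "Z \<omega> = sqrt (t / G 1 \<omega>)" for \<omega>
  have rvG[measurable]: "random_variable borel (G 1)"
    using stable_subordinator_half(1)[OF G] by simp
  have [measurable]: "random_variable borel H" "random_variable borel Z"
    unfolding H_def Z_def[abs_def] by simp_all
  have pos: "AE \<omega> in M. 0 < G 1 \<omega>"
    using stable_subordinator_half(2)[OF G, of 1] by (intro AE_pos_if_Laplace[of _ 1]) auto
  have cdf: "cdf (distr M borel X) x = prob {\<omega> \<in> space M. X \<omega> \<le> x}"
    if [measurable]: "random_variable borel X" for X x
    by (simp add: cdf_def measure_distr vimage_def Int_def conj_commute)
  have scale: "prob {\<omega> \<in> space M. t < G y \<omega>} = prob {\<omega> \<in> space M. t < y\<^sup>2 * G 1 \<omega>}" if "0 \<le> y" for y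
  proof -
    have [measurable]: "random_variable borel (G y)"
      using stable_subordinator_half(1)[OF G that] .
    have "measure (distr M borel (G y)) {t<..} = measure (distr M borel (\<lambda>\<omega>. y\<^sup>2 * G 1 \<omega>)) {t<..}"
      using stable_subordinator_half_scaling[OF G that] by simp
    then show ?thesis
      by (simp add: measure_distr vimage_def Int_def conj_commute)
  qed
  have HZ: "prob {\<omega> \<in> space M. H \<omega> \<le> x} \<le> prob {\<omega> \<in> space M. Z \<omega> \<le> y}" if "x < y" for x y
  proof (cases "0 \<le> x")
    case True
    then have "0 \<le> y" "0 < y" using that by auto
    have [measurable]: "random_variable borel (G y)"
      using stable_subordinator_half(1)[OF G \<open>0 \<le> y\<close>] .
    have "prob {\<omega> \<in> space M. H \<omega> \<le> x} \<le> prob {\<omega> \<in> space M. t < G y \<omega>}"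
    proof (rule finite_measure_mono_AE)
      \<comment> \<open>Almost sure unboundedness excludes the default value 0, so \<open>H\<close>
        is a genuine infimum here.\<close>
      show "AE \<omega> in M. \<omega> \<in> {\<omega> \<in> space M. H \<omega> \<le> x} \<longrightarrow> \<omega> \<in> {\<omega> \<in> space M. t < G y \<omega>}"
        using stable_subordinator_half_unbounded[OF G, of t] AE_space
      proof eventually_elim
        case (elim \<omega>)
        show ?case
        proof safe
          assume "H \<omega> \<le> x"
          then have "Inf {s. 0 \<le> s \<and> t < G s \<omega>} < y"
            using elim that by (auto simp: H_def first_hitting_process_def)
          then obtain s where "0 \<le> s" "t < G s \<omega>" "s < y"
            using cInf_lessD[of "{s. 0 \<le> s \<and> t < G s \<omega>}" y] elim by auto
          then show "t < G y \<omega>"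
            using stable_subordinator_half(3)[OF G, of \<omega> s y] elim by simp
        qed
      qed
    qed simp
    also have "\<dots> = prob {\<omega> \<in> space M. t < y\<^sup>2 * G 1 \<omega>}"
      using scale[OF \<open>0 \<le> y\<close>] .
    also have "\<dots> \<le> prob {\<omega> \<in> space M. Z \<omega> \<le> y}"
    proof (rule finite_measure_mono_AE)
      show "AE \<omega> in M. \<omega> \<in> {\<omega> \<in> space M. t < y\<^sup>2 * G 1 \<omega>} \<longrightarrow> \<omega> \<in> {\<omega> \<in> space M. Z \<omega> \<le> y}"
        using pos by eventually_elim
          (use \<open>0 < y\<close> in \<open>auto simp: Z_def intro!: real_le_lsqrt simp: pos_divide_le_eq\<close>)
    qed simp
    finally show ?thesis .
  next
    case False
    have "0 \<le> H \<omega>" for \<omega>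
      by (simp add: H_def first_hitting_process_nonneg)
    then have "{\<omega> \<in> space M. H \<omega> \<le> x} = {}"
      using False by (auto dest: order_trans)
    then show ?thesis by (simp only: measure_empty measure_nonneg)
  qed
  have ZH: "prob {\<omega> \<in> space M. Z \<omega> \<le> x} \<le> prob {\<omega> \<in> space M. H \<omega> \<le> y}" if "x < y" for x y
  proof -
    \<comment> \<open>\<open>Z\<close> is almost surely nonnegative, so the left event is null for
      \<open>x < 0\<close>; the conjunct \<open>0 \<le> x\<close> lets one inclusion cover both
      signs of \<open>x\<close>.\<close>
    have "prob {\<omega> \<in> space M. Z \<omega> \<le> x} \<le> prob {\<omega> \<in> space M. t < (max y 0)\<^sup>2 * G 1 \<omega> \<and> 0 \<le> x}"
    proof (rule finite_measure_mono_AE)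
      show "AE \<omega> in M. \<omega> \<in> {\<omega> \<in> space M. Z \<omega> \<le> x} \<longrightarrow> \<omega> \<in> {\<omega> \<in> space M. t < (max y 0)\<^sup>2 * G 1 \<omega> \<and> 0 \<le> x}"
        using pos AE_space
      proof eventually_elim
        case (elim \<omega>)
        show ?case
        proof
          assume "\<omega> \<in> {\<omega> \<in> space M. Z \<omega> \<le> x}"
          then have *: "sqrt (t / G 1 \<omega>) \<le> x" by (simp add: Z_def)
          have "0 \<le> sqrt (t / G 1 \<omega>)" using elim \<open>0 < t\<close> by simp
          with * have x: "0 \<le> x" by linarith
          have "t / G 1 \<omega> \<le> x\<^sup>2"
            using * by (rule sqrt_le_D)
          also have "x\<^sup>2 < (max y 0)\<^sup>2"
            using x that by (intro power_strict_mono) auto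
          finally show "\<omega> \<in> {\<omega> \<in> space M. t < (max y 0)\<^sup>2 * G 1 \<omega> \<and> 0 \<le> x}"
            using elim x by (simp add: pos_divide_less_eq)
        qed
      qed
    qed simp
    also have "\<dots> \<le> prob {\<omega> \<in> space M. H \<omega> \<le> y}"
    proof (cases "0 \<le> x")
      case True
      then have "0 \<le> y" using that by simp
      have "prob {\<omega> \<in> space M. t < (max y 0)\<^sup>2 * G 1 \<omega> \<and> 0 \<le> x} = prob {\<omega> \<in> space M. t < G y \<omega>}"
        using scale[OF \<open>0 \<le> y\<close>] True \<open>0 \<le> y\<close> by (simp add: max_absorb1)
      also have "\<dots> \<le> prob {\<omega> \<in> space M. H \<omega> \<le> y}"
        using \<open>0 \<le> y\<close> by (intro finite_measure_mono) (auto simp: H_def first_hitting_process_le)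
      finally show ?thesis .
    qed simp
    finally show ?thesis .
  qed
  have dist: "real_distribution (distr M borel H)" "real_distribution (distr M borel Z)"
    by (rule real_distribution_distr; simp)+
  have "distr M borel H = distr M borel Z"
  proof (rule cdf_unique[OF dist], rule ext)
    fix x
    show "cdf (distr M borel H) x = cdf (distr M borel Z) x"
      using HZ ZH by (intro antisym cdf_le_if_less dist) (simp_all add: cdf)
  qed
  then show ?thesis
    by (simp add: H_def Z_def[abs_def])
qed

text \<open>Read off from the law of \<open>sqrt (t / G 1)\<close>. Positivity matters because the
  series for the probabilities is established at positive times.\<close>

lemma AE_first_hitting_process_pos:
  assumes G: "stable_subordinator (1/2) G" and "0 < t"
    and [measurable]: "random_variable borel (first_hitting_process G t)"
  shows "AE \<omega> in M. 0 < first_hitting_process G t \<omega>"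
proof -
  have [measurable]: "random_variable borel (G 1)"
    using stable_subordinator_half(1)[OF G] by simp
  have "AE \<omega> in M. 0 < G 1 \<omega>"
    using stable_subordinator_half(2)[OF G, of 1] by (intro AE_pos_if_Laplace[of _ 1]) auto
  then have "AE \<omega> in M. 0 < sqrt (t / G 1 \<omega>)"
    by eventually_elim (use \<open>0 < t\<close> in simp)
  then have "AE x in distr M borel (first_hitting_process G t). 0 < x"
    unfolding distr_first_hitting_process[OF assms] by (simp add: AE_distr_iff)
  then show ?thesis
    by (simp add: AE_distr_iff)
qed

lemma nn_integral_first_hitting_process_powr:
  assumes G: "stable_subordinator (1/2) G" and "0 < t" "0 < a"
    and [measurable]: "random_variable borel (first_hitting_process G t)"
  shows "(\<integral>\<^sup>+\<omega>. ennreal (first_hitting_process G t \<omega> powr a) \<partial>M)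
    = ennreal (Gamma (a + 1) / Gamma (a / 2 + 1) * t powr (a / 2))"
proof -
  have [measurable]: "random_variable borel (G 1)"
    using stable_subordinator_half(1)[OF G] by simp
  have pos: "AE \<omega> in M. 0 < G 1 \<omega>"
    using stable_subordinator_half(2)[OF G, of 1] by (intro AE_pos_if_Laplace[of _ 1]) auto
  have "(\<integral>\<^sup>+\<omega>. ennreal (first_hitting_process G t \<omega> powr a) \<partial>M)
    = (\<integral>\<^sup>+x. ennreal (x powr a) \<partial>distr M borel (first_hitting_process G t))"
    by (subst nn_integral_distr) auto
  also have "\<dots> = (\<integral>\<^sup>+\<omega>. ennreal (sqrt (t / G 1 \<omega>) powr a) \<partial>M)"
    unfolding distr_first_hitting_process[OF assms(1,2,4)] by (subst nn_integral_distr) auto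
  also have "\<dots> = (\<integral>\<^sup>+\<omega>. ennreal (t powr (a / 2)) * ennreal (G 1 \<omega> powr (- (a / 2))) \<partial>M)"
  proof (rule nn_integral_cong_AE)
    show "AE \<omega> in M. ennreal (sqrt (t / G 1 \<omega>) powr a) = ennreal (t powr (a / 2)) * ennreal (G 1 \<omega> powr (- (a / 2)))"
      using pos
    proof eventually_elim
      case (elim \<omega>)
      have root: "sqrt (t / G 1 \<omega>) = (t / G 1 \<omega>) powr (1 / 2)"
        using elim \<open>0 < t\<close> by (intro powr_half_sqrt[symmetric]) simp
      have "sqrt (t / G 1 \<omega>) powr a = (t / G 1 \<omega>) powr (a / 2)"
        unfolding root powr_powr by simp
      also have "\<dots> = t powr (a / 2) * G 1 \<omega> powr (- (a / 2))"
        using elim \<open>0 < t\<close> by (simp add: powr_divide powr_minus_divide)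
      finally have "sqrt (t / G 1 \<omega>) powr a = t powr (a / 2) * G 1 \<omega> powr (- (a / 2))" .
      then show ?case by (simp add: ennreal_mult')
    qed
  qed
  also have "\<dots> = ennreal (t powr (a / 2)) * ennreal (Gamma (2 * (a / 2) + 1) / Gamma (a / 2 + 1))"
    using stable_subordinator_half(2)[OF G, of 1] \<open>0 < a\<close>
    by (subst nn_integral_cmult, simp, subst nn_integral_negative_moment) auto
  finally show ?thesis
    by (simp add: ennreal_mult'[symmetric] mult.commute)
qed

lemma first_hitting_process_moments:
  assumes G: "stable_subordinator (1/2) G" and "0 < t" "0 < \<beta>"
    and [measurable]: "random_variable borel (first_hitting_process G t)"
  shows "integrable M (\<lambda>\<omega>. (first_hitting_process G t \<omega> powr \<beta>) ^ j)"
    and "expectation (\<lambda>\<omega>. (first_hitting_process G t \<omega> powr \<beta>) ^ j)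
      = Gamma (real j * \<beta> + 1) / Gamma (real j * (\<beta> / 2) + 1) * (t powr (\<beta> / 2)) ^ j"
proof -
  \<comment> \<open>The case \<open>j = 0\<close> is separate because \<open>0 powr 0 = 0\<close>
    while a zeroth power is 1. For \<open>j > 0\<close> the exponents can be multiplied even where
    the hitting time is 0.\<close>
  have "has_bochner_integral M (\<lambda>\<omega>. (first_hitting_process G t \<omega> powr \<beta>) ^ j)
    (Gamma (real j * \<beta> + 1) / Gamma (real j * (\<beta> / 2) + 1) * (t powr (\<beta> / 2)) ^ j)"
  proof (cases "j = 0")
    case True
    then show ?thesis
      by (simp add: has_bochner_integral_iff prob_space)
  next
    case False
    then have j: "0 < real j * \<beta>" using \<open>0 < \<beta>\<close> by simp
    have pow: "(first_hitting_process G t \<omega> powr \<beta>) ^ j = first_hitting_process G t \<omega> powr (real j * \<beta>)" for \<omega>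
      using first_hitting_process_nonneg[of G t \<omega>] False
      by (cases "first_hitting_process G t \<omega> = 0") (simp_all add: powr_real_mult_power)
    show ?thesis
    proof (rule has_bochner_integral_nn_integral)
      show "0 \<le> Gamma (real j * \<beta> + 1) / Gamma (real j * (\<beta> / 2) + 1) * (t powr (\<beta> / 2)) ^ j"
        using j by (intro mult_nonneg_nonneg divide_nonneg_nonneg) (auto intro!: less_imp_le[OF Gamma_real_pos])
      show "(\<integral>\<^sup>+\<omega>. ennreal ((first_hitting_process G t \<omega> powr \<beta>) ^ j) \<partial>M)
        = ennreal (Gamma (real j * \<beta> + 1) / Gamma (real j * (\<beta> / 2) + 1) * (t powr (\<beta> / 2)) ^ j)"
        unfolding pow using nn_integral_first_hitting_process_powr[OF assms(1,2) j assms(4)] \<open>0 < t\<close>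
        by (simp add: powr_real_mult_power)
    qed simp_all
  qed
  then show "integrable M (\<lambda>\<omega>. (first_hitting_process G t \<omega> powr \<beta>) ^ j)"
    and "expectation (\<lambda>\<omega>. (first_hitting_process G t \<omega> powr \<beta>) ^ j)
      = Gamma (real j * \<beta> + 1) / Gamma (real j * (\<beta> / 2) + 1) * (t powr (\<beta> / 2)) ^ j"
    by (auto simp: has_bochner_integral_iff)
qed

text \<open>The moment of order \<open>j * \<beta>\<close> carries the factor
  \<open>Gamma (j * \<beta> + 1)\<close>, which cancels the denominator and leaves the one for
  \<open>\<beta> / 2\<close>. Sum and expectation may be exchanged because the expected absolute
  terms form a convergent series of the same type.\<close>

lemma first_hitting_process_mittag_leffler:
  assumes G: "stable_subordinator (1/2) G" and "0 < t" "0 < \<beta>" and a: "\<And>j. \<bar>a j\<bar> \<le> C ^ j"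
    and rv: "random_variable borel (first_hitting_process G t)"
  defines "f \<equiv> \<lambda>x. \<Sum>j. a j * (x powr \<beta>) ^ j / Gamma (real j * \<beta> + 1)"
  shows "integrable M (\<lambda>\<omega>. f (first_hitting_process G t \<omega>))"
    and "expectation (\<lambda>\<omega>. f (first_hitting_process G t \<omega>))
      = (\<Sum>j. a j * (t powr (\<beta> / 2)) ^ j / Gamma (real j * (\<beta> / 2) + 1))"
proof -
  define g where "g j \<omega> = a j * (first_hitting_process G t \<omega> powr \<beta>) ^ j / Gamma (real j * \<beta> + 1)" for j \<omega>
  have Gam: "0 < Gamma (real j * \<beta> + 1)" for j
    using \<open>0 < \<beta>\<close> by (intro Gamma_real_pos) (auto intro: add_nonneg_pos)
  have moment: "expectation (\<lambda>\<omega>. b * (first_hitting_process G t \<omega> powr \<beta>) ^ j / Gamma (real j * \<beta> + 1))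
      = b * (t powr (\<beta> / 2)) ^ j / Gamma (real j * (\<beta> / 2) + 1)" for b j
    using first_hitting_process_moments[OF assms(1-3) rv, of j] Gam[of j] by simp
  have int: "integrable M (g j)" for j
    unfolding g_def[abs_def] using first_hitting_process_moments(1)[OF assms(1-3) rv, of j]
    by (intro Bochner_Integration.integrable_divide integrable_mult_right)
  have norm: "norm (g j \<omega>) = \<bar>a j\<bar> * (first_hitting_process G t \<omega> powr \<beta>) ^ j / Gamma (real j * \<beta> + 1)" for j \<omega>
    using Gam[of j] by (simp add: g_def abs_mult)
  have sum1: "AE \<omega> in M. summable (\<lambda>j. norm (g j \<omega>))"
    using summable_mittag_leffler[OF \<open>0 < \<beta>\<close> a] by (simp add: g_def)
  have "summable (\<lambda>j. \<bar>a j * (t powr (\<beta> / 2)) ^ j / Gamma (real j * (\<beta> / 2) + 1)\<bar>)"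
    using summable_mittag_leffler[OF _ a, of "\<beta> / 2" "t powr (\<beta> / 2)"] \<open>0 < \<beta>\<close> by simp
  moreover have "\<bar>Gamma (real j * (\<beta> / 2) + 1)\<bar> = Gamma (real j * (\<beta> / 2) + 1)" for j
    using \<open>0 < \<beta>\<close> by (intro abs_of_pos Gamma_real_pos) (auto intro: add_nonneg_pos)
  ultimately have sum2: "summable (\<lambda>j. expectation (\<lambda>\<omega>. norm (g j \<omega>)))"
    unfolding norm moment by (simp add: abs_mult del: times_divide_eq_right)
  show "integrable M (\<lambda>\<omega>. f (first_hitting_process G t \<omega>))"
    using integrable_suminf[OF int sum1 sum2] by (simp add: f_def g_def)
  show "expectation (\<lambda>\<omega>. f (first_hitting_process G t \<omega>))
      = (\<Sum>j. a j * (t powr (\<beta> / 2)) ^ j / Gamma (real j * (\<beta> / 2) + 1))"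
    using integral_suminf[OF int sum1 sum2] unfolding f_def g_def moment .
qed

end

section \<open>Composition of independent right continuous processes\<close>

text \<open>
  Unlike \<open>at_right x\<close>, this filter contains \<open>x\<close> itself, so that it can be composed along maps
  that are locally constant to the right of \<open>x\<close>, as first hitting processes may be.
\<close>

definition at_right_closed :: "real \<Rightarrow> real filter" where
  "at_right_closed x = inf (nhds x) (principal {x..})"

lemma eventually_at_right_closed:
  "eventually P (at_right_closed x) \<longleftrightarrow> P x \<and> eventually P (at_right x)"
proof -
  have "eventually P (at_right x) \<longleftrightarrow> eventually (\<lambda>y. y \<noteq> x \<longrightarrow> y \<in> {x<..} \<longrightarrow> P y) (nhds x)"
    by (rule eventually_at_filter)
  moreover have "eventually P (at_right_closed x) \<longleftrightarrow> eventually (\<lambda>y. y \<in> {x..} \<longrightarrow> P y) (nhds x)"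
    unfolding at_right_closed_def by (rule eventually_inf_principal)
  ultimately show ?thesis
    by (auto elim: eventually_mono dest: eventually_nhds_x_imp_x)
qed

lemma tendsto_at_right_closed:
  assumes "(f \<longlongrightarrow> f x) (at_right x)"
  shows "(f \<longlongrightarrow> f x) (at_right_closed x)"
  using assms unfolding tendsto_def eventually_at_right_closed by auto

text \<open>If \<open>G s\<close> exceeds the level \<open>t\<close>, it also exceeds all slightly
  larger levels, which bounds their hitting times by \<open>s\<close>. Monotonicity is only claimed
  locally, since the value may drop to the default 0 at a level that is never exceeded; from such a
  level on it is constant. No path property of \<open>G\<close> enters.\<close>

lemma first_hitting_process_right_regular:
  "filterlim (\<lambda>t. first_hitting_process G t \<omega>) (at_right_closed (first_hitting_process G t \<omega>)) (at_right_closed t)"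
proof -
  define S where "S u = {s. 0 \<le> s \<and> u < G s \<omega>}" for u
  have bdd: "bdd_below (S u)" for u
    by (auto simp: S_def intro: bdd_belowI[of _ 0])
  define h where "h u = first_hitting_process G u \<omega>" for u
  have h: "h u = (if S u \<noteq> {} then Inf (S u) else 0)" for u
    by (auto simp: h_def first_hitting_process_def S_def)
  have "eventually (\<lambda>u. h t \<le> h u \<and> h u < c) (at_right t)" if "h t < c" for c
  proof (cases "S t = {}")
    case True
    have "h u = h t" if "t < u" for u
    proof -
      have "S u \<subseteq> S t" using that by (auto simp: S_def)
      with True show ?thesis by (simp add: h)
    qed
    with that show ?thesis
      by (auto simp: eventually_at_filter)
  next
    case False
    with that have "Inf (S t) < c" by (simp add: h)
    then obtain s where s: "s \<in> S t" "s < c"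
      using cInf_lessD[OF False] by blast
    then have "t < G s \<omega>" by (simp add: S_def)
    then have "eventually (\<lambda>u. u \<in> {t<..<G s \<omega>}) (at_right t)"
      by (rule eventually_at_right_real)
    then show ?thesis
    proof eventually_elim
      case (elim u)
      then have "s \<in> S u" "S u \<subseteq> S t"
        using s by (auto simp: S_def)
      have "Inf (S u) \<le> s"
        using \<open>s \<in> S u\<close> bdd by (rule cInf_lower)
      moreover have "Inf (S t) \<le> Inf (S u)"
        using \<open>s \<in> S u\<close> by (intro cInf_superset_mono bdd \<open>S u \<subseteq> S t\<close>) auto
      ultimately show ?case using \<open>s \<in> S u\<close> False s(2) by (auto simp: h)
    qed
  qed
  note * = this
  have "filterlim h (at_right_closed (h t)) (at_right_closed t)"
    unfolding at_right_closed_def[of "h t"] filterlim_inf filterlim_principal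
  proof
    have "eventually (\<lambda>u. h t \<le> h u) (at_right t)"
      using *[of "h t + 1"] by (auto elim: eventually_mono)
    then show "\<forall>\<^sub>F u in at_right_closed t. h u \<in> {h t..}"
      by (simp add: eventually_at_right_closed)
    show "filterlim h (nhds (h t)) (at_right_closed t)"
    proof (rule tendsto_at_right_closed, rule order_tendstoI)
      show "eventually (\<lambda>u. c < h u) (at_right t)" if "c < h t" for c
        using *[of "h t + 1"] that by (auto elim!: eventually_mono)
      show "eventually (\<lambda>u. h u < c) (at_right t)" if "h t < c" for c
        using *[OF that] by (auto elim!: eventually_mono)
    qed
  qed
  then show ?thesis by (simp add: h_def[abs_def])
qed

lemma iterated_process_nonneg:
  assumes "\<And>i s. i \<in> {1..n} \<Longrightarrow> 0 \<le> s \<Longrightarrow> 0 \<le> H i s \<omega>" and "0 \<le> t"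
  shows "0 \<le> iterated_process H n t \<omega>"
  using assms by (induction n arbitrary: t) auto

lemma iterated_process_right_regular:
  assumes "\<And>i s. i \<in> {1..n} \<Longrightarrow> filterlim (\<lambda>s. H i s \<omega>) (at_right_closed (H i s \<omega>)) (at_right_closed s)"
  shows "filterlim (\<lambda>t. iterated_process H n t \<omega>) (at_right_closed (iterated_process H n t \<omega>)) (at_right_closed t)"
  using assms
proof (induction n arbitrary: t)
  case 0
  show ?case by (simp add: filterlim_ident)
next
  case (Suc n)
  have "filterlim (\<lambda>s. iterated_process H n s \<omega>)
      (at_right_closed (iterated_process H n (H (Suc n) t \<omega>) \<omega>)) (at_right_closed (H (Suc n) t \<omega>))"
    using Suc by simp
  moreover have "filterlim (\<lambda>s. H (Suc n) s \<omega>) (at_right_closed (H (Suc n) t \<omega>)) (at_right_closed t)"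
    using Suc.prems by simp
  ultimately show ?case
    unfolding iterated_process.simps by (rule filterlim_compose)
qed

text \<open>
  Joint evaluation of a path at a real argument is not measurable on the product space. The limit
  along rational approximations from above is measurable, and it agrees with evaluation on right
  continuous paths.
\<close>

definition right_eval :: "(real \<Rightarrow> real) \<Rightarrow> real \<Rightarrow> real" where
  "right_eval w y = lim (\<lambda>k. w (real (nat \<lceil>real (Suc k) * y\<rceil>) / real (Suc k)))"

abbreviation path_space :: "(real \<Rightarrow> real) measure" where
  "path_space \<equiv> PiM {0..} (\<lambda>_. borel)"

abbreviation (input) sample_path :: "(real \<Rightarrow> 'a \<Rightarrow> real) \<Rightarrow> 'a \<Rightarrow> real \<Rightarrow> real" where
  "sample_path X \<omega> \<equiv> \<lambda>s\<in>{0..}. X s \<omega>"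

text \<open>For fixed \<open>k\<close> the evaluation point takes countably many values, so the
  approximation is pieced together from countably many coordinate maps.\<close>

lemma measurable_right_eval[measurable]:
  "(\<lambda>(w, y). right_eval w y) \<in> borel_measurable (path_space \<Otimes>\<^sub>M borel)"
proof -
  have "(\<lambda>x. fst x (real (nat \<lceil>real (Suc k) * snd x\<rceil>) / real (Suc k))) \<in> borel_measurable (path_space \<Otimes>\<^sub>M borel)" for k
  proof (rule measurable_compose_countable[where f = "\<lambda>i x. fst x (real i / real (Suc k))" and g = "\<lambda>x. nat \<lceil>real (Suc k) * snd x\<rceil>"])
    show "(\<lambda>x. fst x (real i / real (Suc k))) \<in> borel_measurable (path_space \<Otimes>\<^sub>M borel)" for i
      by (rule measurable_compose[OF measurable_fst]) (rule measurable_component_singleton, simp)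
  qed measurable
  then show ?thesis
    unfolding right_eval_def case_prod_unfold by (rule borel_measurable_lim_metric)
qed

text \<open>The grid points lie between \<open>y\<close> and \<open>y + 1 / Suc k\<close> and may
  equal \<open>y\<close>, which is why the hypothesis uses \<open>at_right_closed\<close>.\<close>

lemma right_eval_path:
  assumes "0 \<le> y" and "((\<lambda>s. X s \<omega>) \<longlongrightarrow> X y \<omega>) (at_right_closed y)"
  shows "right_eval (sample_path X \<omega>) y = X y \<omega>"
proof -
  define d where "d k = real (nat \<lceil>real (Suc k) * y\<rceil>) / real (Suc k)" for k
  have d: "y \<le> d k" "d k \<le> y + 1 / real (Suc k)" for k
  proof -
    have "real (nat \<lceil>real (Suc k) * y\<rceil>) = real_of_int \<lceil>real (Suc k) * y\<rceil>"
    proof (rule of_nat_nat)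
      have "0 \<le> real (Suc k) * y" using \<open>0 \<le> y\<close> by (intro mult_nonneg_nonneg) simp_all
      then show "0 \<le> \<lceil>real (Suc k) * y\<rceil>" by linarith
    qed
    then have "real (Suc k) * y \<le> real (nat \<lceil>real (Suc k) * y\<rceil>)"
      "real (nat \<lceil>real (Suc k) * y\<rceil>) \<le> real (Suc k) * y + 1"
      by linarith+
    then have "real (Suc k) * y / real (Suc k) \<le> d k" "d k \<le> (real (Suc k) * y + 1) / real (Suc k)"
      unfolding d_def by (intro divide_right_mono; simp)+
    then show "y \<le> d k" "d k \<le> y + 1 / real (Suc k)"
      by (simp_all add: add_divide_distrib del: of_nat_Suc)
  qed
  have "(\<lambda>k. y + 1 / real (Suc k)) \<longlonglongrightarrow> y + 0"
    by (intro tendsto_add tendsto_const) (use LIMSEQ_inverse_real_of_nat in \<open>simp add: inverse_eq_divide\<close>)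
  then have "d \<longlonglongrightarrow> y"
    by (intro tendsto_sandwich[OF _ _ tendsto_const, of y d sequentially "\<lambda>k. y + 1 / real (Suc k)"]) (use d in auto)
  then have "filterlim d (at_right_closed y) sequentially"
    unfolding at_right_closed_def filterlim_inf filterlim_principal using d by simp
  then have "(\<lambda>k. X (d k) \<omega>) \<longlonglongrightarrow> X y \<omega>"
    by (rule filterlim_compose[OF assms(2)])
  moreover have "sample_path X \<omega> (d k) = X (d k) \<omega>" for k
    using d(1)[of k] \<open>0 \<le> y\<close> by auto
  ultimately show ?thesis
    unfolding right_eval_def d_def[symmetric] by (simp add: limI)
qed

text \<open>By independence the joint law of the two paths is a product measure, and Tonelli freezes
  the second path. \<open>U\<close> and \<open>V\<close> are kept apart from the sample paths
  because they need to agree with them on \<open>space M\<close> only.\<close>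

lemma (in prob_space) emeasure_subordinated_process:
  assumes indep: "indep_var path_space U path_space V" and "0 \<le> t"
    and U: "\<And>\<omega>. \<omega> \<in> space M \<Longrightarrow> U \<omega> = sample_path X \<omega>"
    and V: "\<And>\<omega>. \<omega> \<in> space M \<Longrightarrow> V \<omega> = sample_path Y \<omega>"
    and Y: "\<And>\<omega>. \<omega> \<in> space M \<Longrightarrow> 0 \<le> Y t \<omega>"
    and X: "\<And>\<omega> y. \<omega> \<in> space M \<Longrightarrow> 0 \<le> y \<Longrightarrow> ((\<lambda>s. X s \<omega>) \<longlongrightarrow> X y \<omega>) (at_right_closed y)"
    and A[measurable]: "A \<in> sets borel"
  shows "emeasure M {\<omega> \<in> space M. X (Y t \<omega>) \<omega> \<in> A}
    = (\<integral>\<^sup>+\<omega>'. emeasure M {\<omega> \<in> space M. X (Y t \<omega>') \<omega> \<in> A} \<partial>M)"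
proof -
  have rv[measurable]: "random_variable path_space U" "random_variable path_space V"
    using indep_var_rv1[OF indep] indep_var_rv2[OF indep] by auto
  interpret X: prob_space "distr M path_space U"
    by (rule prob_space_distr) simp
  interpret Y: prob_space "distr M path_space V"
    by (rule prob_space_distr) simp
  interpret XY: pair_sigma_finite "distr M path_space U" "distr M path_space V" ..
  define B where "B = {x \<in> space (path_space \<Otimes>\<^sub>M path_space). right_eval (fst x) (snd x t) \<in> A}"
  have "(\<lambda>x. (fst x, snd x t)) \<in> measurable (path_space \<Otimes>\<^sub>M path_space) (path_space \<Otimes>\<^sub>M borel)"
    using \<open>0 \<le> t\<close>
    by (intro measurable_Pair measurable_fst measurable_compose[OF measurable_snd measurable_component_singleton]) simp
  from measurable_compose[OF this measurable_right_eval]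
  have [measurable]: "(\<lambda>x. right_eval (fst x) (snd x t)) \<in> borel_measurable (path_space \<Otimes>\<^sub>M path_space)"
    by simp
  have B[measurable]: "B \<in> sets (path_space \<Otimes>\<^sub>M path_space)"
    unfolding B_def by measurable
  have path: "U \<omega> \<in> space path_space" "V \<omega> \<in> space path_space" if "\<omega> \<in> space M" for \<omega>
    using measurable_space[OF rv(1) that] measurable_space[OF rv(2) that] by auto
  have "emeasure M {\<omega> \<in> space M. X (Y t \<omega>) \<omega> \<in> A} = emeasure M ((\<lambda>\<omega>. (U \<omega>, V \<omega>)) -` B \<inter> space M)"
    using path Y X U V \<open>0 \<le> t\<close> by (intro arg_cong[where f = "emeasure M"])
      (auto simp: B_def space_pair_measure right_eval_path)
  also have "\<dots> = emeasure (distr M (path_space \<Otimes>\<^sub>M path_space) (\<lambda>\<omega>. (U \<omega>, V \<omega>))) B"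
    by (rule emeasure_distr[symmetric]) measurable
  also have "\<dots> = emeasure (distr M path_space U \<Otimes>\<^sub>M distr M path_space V) B"
    using indep by (simp add: indep_var_distribution_eq)
  also have "\<dots> = (\<integral>\<^sup>+v. emeasure (distr M path_space U) ((\<lambda>w. (w, v)) -` B) \<partial>distr M path_space V)"
    by (rule XY.emeasure_pair_measure_alt2) simp
  also have "\<dots> = (\<integral>\<^sup>+\<omega>'. emeasure (distr M path_space U) ((\<lambda>w. (w, V \<omega>')) -` B) \<partial>M)"
    by (rule nn_integral_distr[OF rv(2)]) (rule measurable_cong_sets[THEN equalityD1, THEN subsetD, OF _ refl XY.measurable_emeasure_Pair2]; simp)
  also have "\<dots> = (\<integral>\<^sup>+\<omega>'. emeasure M {\<omega> \<in> space M. X (Y t \<omega>') \<omega> \<in> A} \<partial>M)"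
  proof (rule nn_integral_cong)
    fix \<omega>' assume \<omega>': "\<omega>' \<in> space M"
    have "emeasure (distr M path_space U) ((\<lambda>w. (w, V \<omega>')) -` B) = emeasure M (U -` ((\<lambda>w. (w, V \<omega>')) -` B) \<inter> space M)"
      by (rule emeasure_distr[OF rv(1) sets_Pair2[OF B]])
    also have "U -` ((\<lambda>w. (w, V \<omega>')) -` B) \<inter> space M = {\<omega> \<in> space M. X (Y t \<omega>') \<omega> \<in> A}"
      using path path(2)[OF \<omega>'] Y[OF \<omega>'] X U V[OF \<omega>'] \<open>0 \<le> t\<close> by (auto simp: B_def space_pair_measure right_eval_path)
    finally show "emeasure (distr M path_space U) ((\<lambda>w. (w, V \<omega>')) -` B) = emeasure M {\<omega> \<in> space M. X (Y t \<omega>') \<omega> \<in> A}" .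
  qed
  finally show ?thesis .
qed

text \<open>The composition as a function of a tuple of paths, with the outermost process at index
  0. In this form it is measurable on the product of path spaces, so independence passes to the
  composed process.\<close>

primrec composed_path :: "nat \<Rightarrow> (nat \<Rightarrow> real \<Rightarrow> real) \<Rightarrow> real \<Rightarrow> real" where
  "composed_path 0 w = w 0"
| "composed_path (Suc n) w = (\<lambda>s\<in>{0..}. right_eval (composed_path n w) (w (Suc n) s))"

lemma measurable_composed_path:
  assumes "{0..n} \<subseteq> I"
  shows "composed_path n \<in> measurable (PiM I (\<lambda>_. path_space)) path_space"
  using assms
proof (induction n)
  case 0
  then show ?case by (simp add: measurable_component_singleton)
next
  case (Suc n)
  have "(\<lambda>w. right_eval (composed_path n w) (w (Suc n) s)) \<in> borel_measurable (PiM I (\<lambda>_. path_space))"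
    if "0 \<le> s" for s
  proof -
    have "(\<lambda>w. w (Suc n) s) \<in> borel_measurable (PiM I (\<lambda>_. path_space))"
      using Suc.prems that
      by (intro measurable_compose[OF measurable_component_singleton[of "Suc n"] measurable_component_singleton]) auto
    then have "(\<lambda>w. (composed_path n w, w (Suc n) s)) \<in> measurable (PiM I (\<lambda>_. path_space)) (path_space \<Otimes>\<^sub>M borel)"
      using Suc.prems by (intro measurable_Pair Suc.IH) (auto simp: subset_iff)
    from measurable_compose[OF this measurable_right_eval] show ?thesis by simp
  qed
  then show ?case
    unfolding composed_path.simps by (intro measurable_restrict) simp
qed

text \<open>Each \<open>right_eval\<close> is a true evaluation because the composition built so far
  is right continuous. Continuity is asked for \<open>i < n\<close> only, as the final composition
  is not evaluated further.\<close>

lemma composed_path_eq: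
  assumes "w 0 = sample_path N \<omega>" and "\<And>i. i \<in> {1..n} \<Longrightarrow> w i = sample_path (H i) \<omega>"
    and "\<And>i s. i \<in> {1..n} \<Longrightarrow> 0 \<le> s \<Longrightarrow> 0 \<le> H i s \<omega>"
    and cont: "\<And>i y. i < n \<Longrightarrow> 0 \<le> y \<Longrightarrow>
      ((\<lambda>s. N (iterated_process H i s \<omega>) \<omega>) \<longlongrightarrow> N (iterated_process H i y \<omega>) \<omega>) (at_right_closed y)"
  shows "composed_path n w = sample_path (\<lambda>s \<omega>. N (iterated_process H n s \<omega>) \<omega>) \<omega>"
  using assms
proof (induction n)
  case 0
  then show ?case by simp
next
  case (Suc n)
  have IH: "composed_path n w = sample_path (\<lambda>s \<omega>. N (iterated_process H n s \<omega>) \<omega>) \<omega>"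
    using Suc by auto
  have "right_eval (composed_path n w) (w (Suc n) s) = N (iterated_process H (Suc n) s \<omega>) \<omega>" if "0 \<le> s" for s
  proof -
    have "w (Suc n) s = H (Suc n) s \<omega>" "0 \<le> H (Suc n) s \<omega>"
      using Suc.prems(2,3)[of "Suc n"] that by auto
    then show ?thesis
      unfolding IH using Suc.prems(4)[of n]
      by (subst right_eval_path[where X = "\<lambda>s \<omega>. N (iterated_process H n s \<omega>) \<omega>"]) auto
  qed
  then show ?case by auto
qed

section \<open>The iterated time change\<close>

lemma abs_backshift_pow_le: "\<bar>(- r) ^ j * (one_minus_backshift ^^ j) unit_mass k\<bar> \<le> (2 * \<bar>r\<bar>) ^ j"
proof -
  have "real (j choose k) \<le> 2 ^ j"
    using binomial_le_pow2[of j k] by (metis of_nat_le_iff of_nat_numeral of_nat_power)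
  then have "\<bar>r\<bar> ^ j * real (j choose k) \<le> \<bar>r\<bar> ^ j * 2 ^ j"
    by (intro mult_left_mono) auto
  then show ?thesis
    by (simp add: backshift_pow_choose abs_mult power_abs power_mult_distrib mult.commute)
qed

text \<open>Induction on the number \<open>m\<close> of time changes, with \<open>n\<close> fixed so
  that joint independence stays available. The new process is applied first: given its value
  \<open>T\<close>, the induction hypothesis supplies the probability at time \<open>T\<close>, and
  averaging over \<open>T\<close> halves the exponent.\<close>

lemma (in prob_space) poisson_iterated_hitting_pmf:
  fixes G H :: "nat \<Rightarrow> real \<Rightarrow> 'a \<Rightarrow> real" and N :: "real \<Rightarrow> 'a \<Rightarrow> nat"
  assumes "0 < r"
    and G: "\<And>i. i \<in> {1..n} \<Longrightarrow> stable_subordinator (1/2) (G i)"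
    and H: "\<And>i. i \<in> {1..n} \<Longrightarrow> H i = first_hitting_process (G i)"
    and N: "poisson_process r N"
    and indep: "independent_processes (\<lambda>i. if i = 0 then (\<lambda>s \<omega>. real (N s \<omega>)) else H i) {0..n}"
    and "m \<le> n" "0 < t"
  shows "prob {\<omega> \<in> space M. N (iterated_process H m t \<omega>) \<omega> = k}
    = (\<Sum>j. ((- r) ^ j * (one_minus_backshift ^^ j) unit_mass k) * (t powr (1 / 2 ^ m)) ^ j
        / Gamma (real j * (1 / 2 ^ m) + 1))"
  using \<open>m \<le> n\<close> \<open>0 < t\<close>
proof (induction m arbitrary: t)
  case 0
  have "(- (r * t)) ^ j = (- r) ^ j * t ^ j" for j
    by (metis mult_minus_left power_mult_distrib)
  then have "(\<lambda>j. ((- r) ^ j * (one_minus_backshift ^^ j) unit_mass k) * t ^ j / fact j)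
      = (\<lambda>j. (- 1) ^ k * real (j choose k) * (- (r * t)) ^ j / fact j)"
    by (simp add: backshift_pow_choose mult_ac)
  then have "(\<lambda>j. ((- r) ^ j * (one_minus_backshift ^^ j) unit_mass k) * t ^ j / fact j)
      sums (exp (- (r * t)) * (r * t) ^ k / fact k)"
    using poisson_pmf_sums[of k "r * t"] by simp
  moreover have "prob {\<omega> \<in> space M. N t \<omega> = k} = exp (- r * t) * (r * t) ^ k / fact k"
    using N 0 by (simp add: poisson_process_def)
  moreover have "Gamma (real j + 1) = fact j" for j
    using Gamma_fact[of j, where 'a = real] by (simp add: add.commute)
  ultimately show ?case
    using 0 by (simp add: sums_iff)
next
  case (Suc m)
  define a where "a j = (- r) ^ j * (one_minus_backshift ^^ j) unit_mass k" for j
  define \<beta> :: real where "\<beta> = 1 / 2 ^ m"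
  define f where "f x = (\<Sum>j. a j * (x powr \<beta>) ^ j / Gamma (real j * \<beta> + 1))" for x
  define F where "F i = sample_path (if i = 0 then (\<lambda>s \<omega>. real (N s \<omega>)) else H i)" for i
  define X where "X s \<omega> = real (N (iterated_process H m s \<omega>) \<omega>)" for s \<omega>
  define T where "T = H (Suc m) t"
  have "0 < \<beta>" by (simp add: \<beta>_def)
  have a: "\<bar>a j\<bar> \<le> (2 * \<bar>r\<bar>) ^ j" for j
    unfolding a_def by (rule abs_backshift_pow_le)
  have Hm: "T = first_hitting_process (G (Suc m)) t" "stable_subordinator (1/2) (G (Suc m))"
    using H G Suc.prems by (auto simp: T_def)
  have F: "indep_vars (\<lambda>_. path_space) F {0..n}"
    using indep unfolding independent_processes_def F_def .
  have H_nonneg: "0 \<le> H i s \<omega>" if "i \<in> {1..n}" for i s \<omega>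
    using H[OF that] by (simp add: first_hitting_process_nonneg)
  have H_regular: "filterlim (\<lambda>s. H i s \<omega>) (at_right_closed (H i s \<omega>)) (at_right_closed s)" if "i \<in> {1..n}" for i s \<omega>
    unfolding H[OF that] by (rule first_hitting_process_right_regular)
  \<comment> \<open>Poisson paths are right continuous, and the iterated hitting times approach
    their value from the right, possibly staying equal to it.\<close>
  have N_cont: "((\<lambda>s. real (N (iterated_process H i s \<omega>) \<omega>)) \<longlongrightarrow> real (N (iterated_process H i y \<omega>) \<omega>)) (at_right_closed y)"
    if "\<omega> \<in> space M" "0 \<le> y" "i \<le> n" for i \<omega> y
  proof -
    have "0 \<le> iterated_process H i y \<omega>"
      using that H_nonneg by (intro iterated_process_nonneg) auto
    with N that(1) have "continuous (at_right (iterated_process H i y \<omega>)) (\<lambda>s. real (N s \<omega>))"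
      by (simp add: poisson_process_def levy_process_def cadlag_paths_def)
    then have "((\<lambda>s. real (N s \<omega>)) \<longlongrightarrow> real (N (iterated_process H i y \<omega>) \<omega>)) (at_right_closed (iterated_process H i y \<omega>))"
      using tendsto_at_right_closed[of "\<lambda>s. real (N s \<omega>)"] by (simp add: continuous_within)
    moreover have "filterlim (\<lambda>s. iterated_process H i s \<omega>) (at_right_closed (iterated_process H i y \<omega>)) (at_right_closed y)"
      using H_regular that by (intro iterated_process_right_regular) auto
    ultimately show ?thesis
      by (rule filterlim_compose)
  qed
  have rv_T: "random_variable borel T"
  proof -
    have "random_variable path_space (F (Suc m))"
      using F Suc.prems by (simp add: indep_vars_def)
    from measurable_compose[OF this measurable_component_singleton[of t]] show ?thesis
      using Suc.prems by (simp add: F_def T_def)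
  qed
  have T_pos: "AE \<omega> in M. 0 < T \<omega>"
    using AE_first_hitting_process_pos[OF Hm(2) Suc.prems(2)] rv_T by (simp add: Hm(1))
  \<comment> \<open>The coefficients have varying signs, so nonnegativity is obtained by recognizing
    the series as a probability.\<close>
  have f_nonneg: "AE \<omega> in M. 0 \<le> f (T \<omega>)"
    using T_pos
  proof eventually_elim
    case (elim \<omega>')
    then have "f (T \<omega>') = prob {\<omega> \<in> space M. N (iterated_process H m (T \<omega>') \<omega>) \<omega> = k}"
      using Suc.IH[OF _ elim] Suc.prems by (simp add: f_def a_def \<beta>_def)
    then show ?case by simp
  qed
  \<comment> \<open>The composed process depends on the paths with indices in \<open>{0..m}\<close>
    only, a block disjoint from \<open>{Suc m}\<close>.\<close>
  have indep2: "indep_var path_space (composed_path m \<circ> (\<lambda>\<omega>. restrict (\<lambda>i. F i \<omega>) {0..m}))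
      path_space ((\<lambda>w. w (Suc m)) \<circ> (\<lambda>\<omega>. restrict (\<lambda>i. F i \<omega>) {Suc m}))"
    using Suc.prems
    by (intro indep_var_compose[OF indep_var_restrict[OF F]] measurable_composed_path measurable_component_singleton) auto
  have "emeasure M {\<omega> \<in> space M. X (T \<omega>) \<omega> \<in> {real k}}
      = (\<integral>\<^sup>+\<omega>'. emeasure M {\<omega> \<in> space M. X (T \<omega>') \<omega> \<in> {real k}} \<partial>M)"
    unfolding T_def
  proof (rule emeasure_subordinated_process[OF indep2])
    show "0 \<le> t" "{real k} \<in> sets borel" using Suc.prems by auto
    show "0 \<le> H (Suc m) t \<omega>" for \<omega>
      using H_nonneg Suc.prems by simp
    show "((\<lambda>s. X s \<omega>) \<longlongrightarrow> X y \<omega>) (at_right_closed y)" if "\<omega> \<in> space M" "0 \<le> y" for \<omega> y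
      unfolding X_def using N_cont that Suc.prems by simp
    show "((\<lambda>w. w (Suc m)) \<circ> (\<lambda>\<omega>. restrict (\<lambda>i. F i \<omega>) {Suc m})) \<omega> = sample_path (H (Suc m)) \<omega>" for \<omega>
      by (simp add: F_def)
    show "(composed_path m \<circ> (\<lambda>\<omega>. restrict (\<lambda>i. F i \<omega>) {0..m})) \<omega> = sample_path X \<omega>" if "\<omega> \<in> space M" for \<omega>
      unfolding X_def comp_def
      by (rule composed_path_eq[where N = "\<lambda>s \<omega>. real (N s \<omega>)"])
        (use N_cont[OF that] H_nonneg Suc.prems in \<open>auto simp: F_def\<close>)
  qed
  also have "\<dots> = (\<integral>\<^sup>+\<omega>'. ennreal (f (T \<omega>')) \<partial>M)"
  proof (rule nn_integral_cong_AE)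
    show "AE \<omega>' in M. emeasure M {\<omega> \<in> space M. X (T \<omega>') \<omega> \<in> {real k}} = ennreal (f (T \<omega>'))"
      using T_pos
    proof eventually_elim
      case (elim \<omega>')
      then show ?case
        using Suc.IH[OF _ elim] Suc.prems by (simp add: X_def f_def a_def \<beta>_def emeasure_eq_measure)
    qed
  qed
  also have "\<dots> = ennreal (expectation (\<lambda>\<omega>. f (T \<omega>)))"
  proof (rule nn_integral_eq_integral)
    show "integrable M (\<lambda>\<omega>. f (T \<omega>))"
      unfolding f_def Hm(1)
      using first_hitting_process_mittag_leffler(1)[OF Hm(2) Suc.prems(2) \<open>0 < \<beta>\<close> a] rv_T Hm(1) by simp
    show "AE \<omega> in M. 0 \<le> f (T \<omega>)" by (rule f_nonneg)
  qed
  finally have "prob {\<omega> \<in> space M. X (T \<omega>) \<omega> \<in> {real k}} = expectation (\<lambda>\<omega>. f (T \<omega>))"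
    using integral_nonneg_AE[OF f_nonneg] by (simp add: emeasure_eq_measure)
  also have "\<dots> = (\<Sum>j. a j * (t powr (\<beta> / 2)) ^ j / Gamma (real j * (\<beta> / 2) + 1))"
    unfolding f_def Hm(1)
    using first_hitting_process_mittag_leffler(2)[OF Hm(2) Suc.prems(2) \<open>0 < \<beta>\<close> a] rv_T Hm(1) by simp
  finally show ?case
    by (simp add: X_def T_def a_def \<beta>_def mult.commute)
qed

section \<open>The differential equation for the time-changed Poisson probabilities\<close>

theorem corollary3p1:
  fixes M :: "'a measure"
    and r :: real
    and n :: nat
    and G H :: "nat \<Rightarrow> real \<Rightarrow> 'a \<Rightarrow> real"
    and N :: "real \<Rightarrow> 'a \<Rightarrow> nat"
    and p q :: "nat \<Rightarrow> real \<Rightarrow> real"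
    and k :: nat
    and t :: real
  assumes "prob_space M"
    and "r > 0"
    and "n \<ge> 1"
    and "\<And>i. i \<in> {1..n} \<Longrightarrow> prob_space.stable_subordinator M (1/2) (G i)"
    and "\<And>i. i \<in> {1..n} \<Longrightarrow> H i = first_hitting_process (G i)"
    and "prob_space.poisson_process M r N"
    and "prob_space.independent_processes M
           (\<lambda>i. if i = 0 then (\<lambda>s \<omega>. real (N s \<omega>)) else H i) {0..n}"
    and "\<And>j x. x \<ge> 0 \<Longrightarrow> p j x = measure M {\<omega> \<in> space M. N x \<omega> = j}"
    and "\<And>j x. x \<ge> 0 \<Longrightarrow> q j x = measure M {\<omega> \<in> space M. N (iterated_process H n x \<omega>) \<omega> = j}"
    and "t > 0"
  shows "(q k has_real_derivative
           (r ^ (2 ^ n) * (one_minus_backshift ^^ (2 ^ n)) (\<lambda>i. q i t) k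
            + (\<Sum>j = 1..2 ^ n - 1.
                 ((- r) ^ j * (one_minus_backshift ^^ j) (\<lambda>i. p i 0) k)
                 * (t powr (- ((2 ^ n - real j) / 2 ^ n)) / Gamma (1 - (2 ^ n - real j) / 2 ^ n)))))
         (at t)"
proof -
  interpret prob_space M by fact
  define m :: nat where "m = 2 ^ n"
  define \<beta> where "\<beta> = 1 / real m"
  define a where "a j i = (- r) ^ j * (one_minus_backshift ^^ j) unit_mass i" for j i
  have a: "\<bar>a j i\<bar> \<le> (2 * \<bar>r\<bar>) ^ j" for i j
    unfolding a_def by (rule abs_backshift_pow_le)
  \<comment> \<open>Evenness, which comes from \<open>n \<ge> 1\<close>, turns
    \<open>(- r) ^ m\<close> into \<open>r ^ m\<close>.\<close>
  have m: "1 \<le> m" "even m"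
    using \<open>n \<ge> 1\<close> by (simp_all add: m_def)
  have "0 < \<beta>"
    using m by (simp add: \<beta>_def)
  have p: "(\<lambda>i. p i 0) = unit_mass"
  proof
    fix i
    show "p i 0 = unit_mass i"
      using assms(6,8) by (cases i) (simp_all add: poisson_process_def unit_mass_def)
  qed
  have q: "q i x = (\<Sum>j. a j i * (x powr \<beta>) ^ j / Gamma (real j * \<beta> + 1))" if "0 < x" for i x
    using poisson_iterated_hitting_pmf[OF assms(2,4,5,6,7) order_refl that, of i] assms(9) that
    by (simp add: a_def \<beta>_def m_def)
  have D: "((\<lambda>x. \<Sum>j. a j k * (x powr \<beta>) ^ j / Gamma (real j * \<beta> + 1)) has_real_derivative
      (\<Sum>i. a (i + m) k * (t powr \<beta>) ^ i / Gamma (real i * \<beta> + 1))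
       + (\<Sum>j = 1..m - 1. a j k * (t powr (real j * \<beta> - 1) / Gamma (real j * \<beta>)))) (at t)"
    unfolding \<beta>_def using m(1) a \<open>t > 0\<close> by (rule mittag_leffler_has_derivative)
  have "(\<Sum>i. a (i + m) k * (t powr \<beta>) ^ i / Gamma (real i * \<beta> + 1))
      = r ^ m * (one_minus_backshift ^^ m) (\<lambda>i. q i t) k"
  proof -
    define c where "c j = (t powr \<beta>) ^ j / Gamma (real j * \<beta> + 1)" for j
    define f where "f j i = c j * a j i" for j i
    have "summable (\<lambda>j. f j i)" for i
      using summable_mittag_leffler[of \<beta> "\<lambda>j. a j i" "2 * \<bar>r\<bar>" "t powr \<beta>", THEN summable_rabs_cancel] a \<open>0 < \<beta>\<close>
      by (simp add: f_def c_def mult.commute)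
    note sum = backshift_pow_suminf[of f, OF this, of m k]
    \<comment> \<open>Applying the operator \<open>m\<close> more times and multiplying by
      \<open>r ^ m\<close> shifts the coefficient index from \<open>j\<close> to
      \<open>j + m\<close>, which matches the tail of the differentiated series.\<close>
    have coeff: "r ^ m * (one_minus_backshift ^^ m) (f j) k = a (j + m) k * (t powr \<beta>) ^ j / Gamma (real j * \<beta> + 1)" for j
    proof -
      have "(one_minus_backshift ^^ m) (f j) k = c j * (- r) ^ j * (one_minus_backshift ^^ (j + m)) unit_mass k"
        unfolding f_def[abs_def] a_def mult.assoc[symmetric]
        by (subst backshift_pow_cmult) (simp add: add.commute[of j m] funpow_add)
      then show ?thesis
        using \<open>even m\<close> by (simp add: a_def c_def power_add)
    qed
    have "(\<lambda>i. q i t) = (\<lambda>i. \<Sum>j. f j i)"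
      using q[OF \<open>t > 0\<close>] by (simp add: f_def c_def mult.commute)
    then have "r ^ m * (one_minus_backshift ^^ m) (\<lambda>i. q i t) k = (\<Sum>j. r ^ m * (one_minus_backshift ^^ m) (f j) k)"
      using sum by (simp add: suminf_mult)
    then show ?thesis
      by (simp add: coeff)
  qed
  moreover have "(\<Sum>j = 1..m - 1. a j k * (t powr (real j * \<beta> - 1) / Gamma (real j * \<beta>)))
      = (\<Sum>j = 1..2 ^ n - 1. ((- r) ^ j * (one_minus_backshift ^^ j) (\<lambda>i. p i 0) k)
                 * (t powr (- ((2 ^ n - real j) / 2 ^ n)) / Gamma (1 - (2 ^ n - real j) / 2 ^ n)))"
  proof -
    have "- ((2 ^ n - real j) / 2 ^ n) = real j * \<beta> - 1" "1 - (2 ^ n - real j) / 2 ^ n = real j * \<beta>" for j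
      by (simp_all add: \<beta>_def m_def field_simps)
    then show ?thesis
      by (simp add: p a_def m_def)
  qed
  ultimately have "((\<lambda>x. \<Sum>j. a j k * (x powr \<beta>) ^ j / Gamma (real j * \<beta> + 1)) has_real_derivative
           (r ^ (2 ^ n) * (one_minus_backshift ^^ (2 ^ n)) (\<lambda>i. q i t) k
            + (\<Sum>j = 1..2 ^ n - 1.
                 ((- r) ^ j * (one_minus_backshift ^^ j) (\<lambda>i. p i 0) k)
                 * (t powr (- ((2 ^ n - real j) / 2 ^ n)) / Gamma (1 - (2 ^ n - real j) / 2 ^ n))))) (at t)"
    using D by (simp add: m_def)
  \<comment> \<open>\<open>q k\<close> is known to equal the series on the open half-line only,
    which suffices for the derivative at a positive time.\<close>
  then show ?thesis
    by (rule has_field_derivative_transform_within_open[OF _ open_greaterThan[of 0]]) (use q \<open>t > 0\<close> in auto)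
qed

end
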